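(* Let $n\ge 1$, let $A=(a_{ij})\in M_n(\mathbb{Z})$ be a skew-symmetric matrix, let $R=\mathbb{C}[X_1,\ldots,X_n]$ be the Poisson algebra with $\{X_i,X_j\}=a_{ij}X_iX_j$, and let $M$ be the Poisson $R$-module which is $R$ as a vector space, with the usual product as $R$-action and with external bracket $\{\cdot,\cdot\}_M$ determined by $\{m,X_i\}_M=-\{X_i,m\}+\left(\sum_{l=1}^n a_{il}\right)X_im$ for all $m\in M$ and $1\le i\le n$. Set $$C=\Big\{\gamma\in\mathbb{N}^n\ \Big|\ \text{for all } 1\le i\le n,\ \gamma_i=0\ \text{ or }\ \sum_{j=1}^n a_{ij}(\gamma_j-1)=0\Big\}.$$ Then for every $k\in\mathbb{N}$ the Poisson homology of $R$ with values in $M$ is $$HP_k(R,M)=\bigoplus_{\substack{\alpha\in\mathbb{N}^n,\ \beta\in\{0,1\}^n\\ |\beta|=k,\ \alpha+\beta\in C}}\mathbb{C}\,X^\alpha dX^\beta,$$ i.e. the elements $X^\alpha dX^\beta$ with $|\beta|=k$ and $\alpha+\beta\in C$ are cycles and their classes form a basis of $HP_k(R,M)$.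
   Context: Notation: $\mathbb{N}$ contains $0$; $X^\alpha=X_1^{\alpha_1}\cdots X_n^{\alpha_n}$; for $\beta\in\{0,1\}^n$, $|\beta|=\sum_i\beta_i$ and $dX^\beta=dX_{i_1}\wedge\cdots\wedge dX_{i_k}$, where $i_1<\cdots<i_k$ are the indices $i$ with $\beta_i=1$; $X^\alpha dX^\beta$ stands for $X^\alpha\otimes dX^\beta\in M\otimes_R\Omega^{k}(R)$. A Poisson algebra is a commutative $\mathbb{C}$-algebra $R$ with a Lie bracket $\{\cdot,\cdot\}$ such that each $\{r,\cdot\}$ is a $\mathbb{C}$-linear derivation of $R$. A Poisson module over $R$ is a $\mathbb{C}$-vector space $M$ with two bilinear maps $\cdot: M\times R\to M$ and $\{\cdot,\cdot\}_M:M\times R\to M$ such that: (1) $(M,\cdot)$ is a (right) module over the commutative algebra $R$; (2) $(M,\{\cdot,\cdot\}_M)$ is a right module over the Lie algebra $(R,\{\cdot,\cdot\})$; (3) $x\cdot\{a,b\}=\{x,a\}_M\cdot b-\{x\cdot b,a\}_M$; (4) $\{x,ab\}_M=\{x,a\}_M\cdot b+\{x,b\}_M\cdot a$, for all $a,b\in R$, $x\in M$. For the module $M$ of the claim, $\{m,a\}_M$ for general $a\in R$ is determined by the values on generators together with (4). Poisson homology: $HP_*(R,M)$ is the homology of the complex $C_k=M\otimes_R\Omega^k(R)$, where $\Omega^k(R)$ is the module of Kähler differential $k$-forms of $R$ over $\mathbb{C}$, with boundary $\partial_k:C_k\to C_{k-1}$, $$\partial_k(m\otimes da_1\wedge\cdots\wedge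 da_k)=\sum_{i=1}^k(-1)^{i+1}\{m,a_i\}_M\otimes da_1\wedge\cdots\widehat{da_i}\cdots\wedge da_k+\sum_{1\le i<j\le k}(-1)^{i+j}m\otimes d\{a_i,a_j\}\wedge da_1\wedge\cdots\widehat{da_i}\cdots\widehat{da_j}\cdots\wedge da_k ,$$ hats denoting omitted terms. *)

theory Defs
  imports "HOL-Analysis.Finite_Cartesian_Product" "HOL-Library.Poly_Mapping"
begin

section \<open>Commutative algebras over the complex numbers\<close>

text \<open>The \<open>\<complex>\<close>-algebra structure is recorded by the structure homomorphism \<open>\<complex> \<rightarrow> R\<close>.\<close>

class comm_complex_algebra = comm_ring_1 +
  fixes of_cx :: "complex \<Rightarrow> 'a"
  assumes of_cx_add: "of_cx (c + d) = of_cx c + of_cx d"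
    and of_cx_mult: "of_cx (c * d) = of_cx c * of_cx d"
    and of_cx_1: "of_cx 1 = 1"

instantiation complex :: comm_complex_algebra
begin
definition of_cx_complex :: "complex \<Rightarrow> complex" where "of_cx_complex c = c"
instance by standard (simp_all add: of_cx_complex_def)
end

instantiation poly_mapping :: (comm_monoid_add, comm_complex_algebra) comm_complex_algebra
begin
definition of_cx_poly_mapping :: "complex \<Rightarrow> 'a \<Rightarrow>\<^sub>0 'b"
  where "of_cx_poly_mapping c = Poly_Mapping.single 0 (of_cx c)"
instance
  by standard
    (simp_all add: of_cx_poly_mapping_def of_cx_add of_cx_mult of_cx_1 single_add mult_single)
end


section \<open>Free modules and congruence modulo a submodule\<close>

definition fscale :: "'r::comm_ring_1 \<Rightarrow> ('g \<Rightarrow>\<^sub>0 'r) \<Rightarrow> ('g \<Rightarrow>\<^sub>0 'r)"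
  where "fscale r x = Poly_Mapping.map ((*) r) x"

lemma lookup_fscale [simp]: "Poly_Mapping.lookup (fscale r x) g = r * Poly_Mapping.lookup x g"
  by (simp add: fscale_def Poly_Mapping.map.rep_eq when_def)

global_interpretation free: module "fscale :: 'r::comm_ring_1 \<Rightarrow> ('g \<Rightarrow>\<^sub>0 'r) \<Rightarrow> ('g \<Rightarrow>\<^sub>0 'r)"
  by standard (auto intro!: poly_mapping_eqI simp: lookup_add algebra_simps)

definition cong_mod :: "('g \<Rightarrow>\<^sub>0 'r::comm_ring_1) set \<Rightarrow> ('g \<Rightarrow>\<^sub>0 'r) \<Rightarrow> ('g \<Rightarrow>\<^sub>0 'r) \<Rightarrow> bool"
  where "cong_mod S x y \<longleftrightarrow> x - y \<in> free.span S"

lemma equivp_cong_mod: "equivp (cong_mod S)"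
proof (rule equivpI)
  show "reflp (cong_mod S)"
    by (simp add: reflp_def cong_mod_def free.span_zero)
  show "symp (cong_mod S)"
  proof (rule sympI)
    fix x y assume "cong_mod S x y"
    then have "- (x - y) \<in> free.span S"
      unfolding cong_mod_def by (rule free.span_neg)
    then show "cong_mod S y x" by (simp add: cong_mod_def)
  qed
  show "transp (cong_mod S)"
  proof (rule transpI)
    fix x y z assume "cong_mod S x y" "cong_mod S y z"
    then have "(x - y) + (y - z) \<in> free.span S"
      unfolding cong_mod_def by (rule free.span_add)
    then show "cong_mod S x z" by (simp add: cong_mod_def)
  qed
qed

lemma cong_mod_refl: "cong_mod S x x"
  using equivp_cong_mod by (rule equivp_reflp)

lemma cong_mod_add: "cong_mod S x y \<Longrightarrow> cong_mod S x' y' \<Longrightarrow> cong_mod S (x + x') (y + y')"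
  unfolding cong_mod_def by (simp add: add_diff_add free.span_add)

lemma cong_mod_uminus: "cong_mod S x y \<Longrightarrow> cong_mod S (- x) (- y)"
  unfolding cong_mod_def using free.span_neg[of "x - y" S] by simp

lemma cong_mod_diff: "cong_mod S x y \<Longrightarrow> cong_mod S x' y' \<Longrightarrow> cong_mod S (x - x') (y - y')"
  using cong_mod_add[OF _ cong_mod_uminus, of S x y x' y'] by simp

lemma cong_mod_fscale: "cong_mod S x y \<Longrightarrow> cong_mod S (fscale r x) (fscale r y)"
  unfolding cong_mod_def
  using free.span_scale[of "x - y" S r] by (simp add: free.scale_right_diff_distrib)


section \<open>Kaehler differentials\<close>

definition kaehler_relations :: "('r::comm_complex_algebra \<Rightarrow>\<^sub>0 'r) set"
  where "kaehler_relations = (let D = (\<lambda>a. Poly_Mapping.single a 1) in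
    {D (a + b) - D a - D b | a b. True} \<union>
    {D (of_cx c * a) - fscale (of_cx c) (D a) | c a. True} \<union>
    {D (a * b) - fscale a (D b) - fscale b (D a) | a b. True})"

text \<open>\<open>\<Omega>\<^sup>1(R)\<close>\<close>

quotient_type (overloaded) 'r kaehler = "'r::comm_complex_algebra \<Rightarrow>\<^sub>0 'r" / "cong_mod kaehler_relations"
  by (rule equivp_cong_mod)

instantiation kaehler :: (comm_complex_algebra) ab_group_add
begin
lift_definition zero_kaehler :: "'a kaehler" is 0 .
lift_definition plus_kaehler :: "'a kaehler \<Rightarrow> 'a kaehler \<Rightarrow> 'a kaehler" is "(+)"
  by (rule cong_mod_add)
lift_definition uminus_kaehler :: "'a kaehler \<Rightarrow> 'a kaehler" is uminus
  by (rule cong_mod_uminus)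
lift_definition minus_kaehler :: "'a kaehler \<Rightarrow> 'a kaehler \<Rightarrow> 'a kaehler" is "(-)"
  by (rule cong_mod_diff)
instance
  by (standard; transfer) (simp_all add: cong_mod_refl algebra_simps)
end

lift_definition kscale :: "'r::comm_complex_algebra \<Rightarrow> 'r kaehler \<Rightarrow> 'r kaehler" is fscale
  by (rule cong_mod_fscale)

lift_definition kd :: "'r::comm_complex_algebra \<Rightarrow> 'r kaehler" is "\<lambda>a. Poly_Mapping.single a 1" .

global_interpretation kaehler: module "kscale :: 'r::comm_complex_algebra \<Rightarrow> _"
  by (standard; transfer) (simp_all add: cong_mod_refl free.scale_left_distrib free.scale_right_distrib)


section \<open>Differential forms\<close>

text \<open>The exterior algebra of the \<open>R\<close>-module \<open>\<Omega>\<^sup>1(R)\<close>. The generator \<open>[\<omega>\<^sub>1, \<dots>, \<omega>\<^sub>k]\<close> stands for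
  \<open>\<omega>\<^sub>1 \<and> \<dots> \<and> \<omega>\<^sub>k\<close>; all relations are homogeneous, so this is the direct sum over \<open>k\<close> of the exterior
  powers.\<close>

definition exterior_relations :: "('r::comm_complex_algebra kaehler list \<Rightarrow>\<^sub>0 'r) set"
  where "exterior_relations = (let W = (\<lambda>ws. Poly_Mapping.single ws 1) in
    {W (us @ (x + y) # vs) - W (us @ x # vs) - W (us @ y # vs) | us vs x y. True} \<union>
    {W (us @ kscale r x # vs) - fscale r (W (us @ x # vs)) | us vs r x. True} \<union>
    {W (us @ x # vs @ x # ws) | us vs ws x. True})"

quotient_type (overloaded) 'r forms =
  "'r::comm_complex_algebra kaehler list \<Rightarrow>\<^sub>0 'r" / "cong_mod exterior_relations"
  by (rule equivp_cong_mod)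

instantiation forms :: (comm_complex_algebra) ab_group_add
begin
lift_definition zero_forms :: "'a forms" is 0 .
lift_definition plus_forms :: "'a forms \<Rightarrow> 'a forms \<Rightarrow> 'a forms" is "(+)"
  by (rule cong_mod_add)
lift_definition uminus_forms :: "'a forms \<Rightarrow> 'a forms" is uminus
  by (rule cong_mod_uminus)
lift_definition minus_forms :: "'a forms \<Rightarrow> 'a forms \<Rightarrow> 'a forms" is "(-)"
  by (rule cong_mod_diff)
instance
  by (standard; transfer) (simp_all add: cong_mod_refl algebra_simps)
end

lift_definition forms_scale :: "'r::comm_complex_algebra \<Rightarrow> 'r forms \<Rightarrow> 'r forms" is fscale
  by (rule cong_mod_fscale)

definition wedge :: "'r::comm_complex_algebra kaehler list \<Rightarrow> 'r forms"
  where "wedge ws = abs_forms (Poly_Mapping.single ws 1)"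

global_interpretation forms: module "forms_scale :: 'r::comm_complex_algebra \<Rightarrow> _"
  by (standard; transfer) (simp_all add: cong_mod_refl free.scale_left_distrib free.scale_right_distrib)

definition k_forms :: "nat \<Rightarrow> 'r::comm_complex_algebra forms set"
  where "k_forms k = forms.span {wedge ws | ws. length ws = k}"

text \<open>\<open>da\<^sub>1 \<and> \<dots> \<and> da\<^sub>k\<close>\<close>

definition dwedge :: "'r::comm_complex_algebra list \<Rightarrow> 'r forms"
  where "dwedge as = wedge (map kd as)"


section \<open>Chains\<close>

text \<open>The tensor product \<open>M \<otimes>\<^sub>R \<Omega>(R)\<close> of all degrees for those modules \<open>M\<close> whose underlying \<open>R\<close>-module
  is \<open>R\<close> with the usual product: the free \<open>R\<close>-module on the pairs \<open>(m, \<omega>)\<close> modulo bilinearity.\<close>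

definition tensor_relations :: "('r::comm_complex_algebra \<times> 'r forms \<Rightarrow>\<^sub>0 'r) set"
  where "tensor_relations = (let T = (\<lambda>m w. Poly_Mapping.single (m, w) 1) in
    {T (m + m') w - T m w - T m' w | m m' w. True} \<union>
    {T m (w + w') - T m w - T m w' | m w w'. True} \<union>
    {T (m * r) w - fscale r (T m w) | r m w. True} \<union>
    {T m (forms_scale r w) - fscale r (T m w) | r m w. True})"

quotient_type (overloaded) 'r chains =
  "'r::comm_complex_algebra \<times> 'r forms \<Rightarrow>\<^sub>0 'r" / "cong_mod tensor_relations"
  by (rule equivp_cong_mod)

instantiation chains :: (comm_complex_algebra) ab_group_add
begin
lift_definition zero_chains :: "'a chains" is 0 .
lift_definition plus_chains :: "'a chains \<Rightarrow> 'a chains \<Rightarrow> 'a chains" is "(+)"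
  by (rule cong_mod_add)
lift_definition uminus_chains :: "'a chains \<Rightarrow> 'a chains" is uminus
  by (rule cong_mod_uminus)
lift_definition minus_chains :: "'a chains \<Rightarrow> 'a chains \<Rightarrow> 'a chains" is "(-)"
  by (rule cong_mod_diff)
instance
  by (standard; transfer) (simp_all add: cong_mod_refl algebra_simps)
end

lift_definition chains_scale :: "'r::comm_complex_algebra \<Rightarrow> 'r chains \<Rightarrow> 'r chains" is fscale
  by (rule cong_mod_fscale)

definition tensor :: "'r::comm_complex_algebra \<Rightarrow> 'r forms \<Rightarrow> 'r chains"  (infixl \<open>\<otimes>\<close> 70)
  where "m \<otimes> w = abs_chains (Poly_Mapping.single (m, w) 1)"

global_interpretation chains: module "chains_scale :: 'r::comm_complex_algebra \<Rightarrow> _"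
  by (standard; transfer) (simp_all add: cong_mod_refl free.scale_left_distrib free.scale_right_distrib)

definition chains_cscale :: "complex \<Rightarrow> 'r::comm_complex_algebra chains \<Rightarrow> 'r chains"
  where "chains_cscale c = chains_scale (of_cx c)"

global_interpretation chains_c: vector_space "chains_cscale :: complex \<Rightarrow> 'r::comm_complex_algebra chains \<Rightarrow> _"
  by standard
    (simp_all add: chains_cscale_def of_cx_add of_cx_mult of_cx_1
      chains.scale_left_distrib chains.scale_right_distrib)

text \<open>\<open>C\<^sub>k = M \<otimes>\<^sub>R \<Omega>\<^sup>k(R)\<close>, which is a direct summand of the tensor product of all degrees.\<close>

definition k_chains :: "nat \<Rightarrow> 'r::comm_complex_algebra chains set"
  where "k_chains k = chains.span {m \<otimes> w | m w. w \<in> k_forms k}"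


section \<open>Poisson algebras and Poisson modules\<close>

locale poisson_algebra =
  fixes pb :: "'r::comm_complex_algebra \<Rightarrow> 'r \<Rightarrow> 'r"
  assumes pb_add_left: "pb (a + b) r = pb a r + pb b r"
    and pb_add_right: "pb r (a + b) = pb r a + pb r b"
    and pb_cscale_left: "pb (of_cx c * a) b = of_cx c * pb a b"
    and pb_cscale_right: "pb a (of_cx c * b) = of_cx c * pb a b"
    and pb_self: "pb a a = 0"
    and jacobi: "pb a (pb b r) + pb b (pb r a) + pb r (pb a b) = 0"
    and pb_leibniz: "pb r (a * b) = pb r a * b + a * pb r b"

text \<open>The \<open>\<complex>\<close>-vector space structure of \<open>M\<close> is \<open>c \<cdot> x = x \<cdot> of_cx c\<close>.\<close>

locale poisson_module = poisson_algebra pb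
  for pb :: "'r::comm_complex_algebra \<Rightarrow> 'r \<Rightarrow> 'r" +
  fixes act :: "'m::ab_group_add \<Rightarrow> 'r \<Rightarrow> 'm"
    and mb :: "'m \<Rightarrow> 'r \<Rightarrow> 'm"
  assumes act_add_left: "act (x + y) a = act x a + act y a"
    and act_add_right: "act x (a + b) = act x a + act x b"
    and act_one: "act x 1 = x"
    and act_mult: "act x (a * b) = act (act x a) b"
    and mb_add_left: "mb (x + y) a = mb x a + mb y a"
    and mb_add_right: "mb x (a + b) = mb x a + mb x b"
    and mb_cscale_left: "mb (act x (of_cx c)) a = act (mb x a) (of_cx c)"
    and mb_cscale_right: "mb x (of_cx c * a) = act (mb x a) (of_cx c)"
    and mb_lie: "mb x (pb a b) = mb (mb x a) b - mb (mb x b) a"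
    and act_pb: "act x (pb a b) = act (mb x a) b - mb (act x b) a"
    and mb_mult: "mb x (a * b) = act (mb x a) b + act (mb x b) a"


section \<open>Poisson homology\<close>

text \<open>List positions start at \<open>0\<close>, so the position \<open>i\<close> below is the index \<open>i + 1\<close> of the classical
  formula; \<open>nths as (- I)\<close> omits the entries at the positions in \<open>I\<close>. The pure tensors
  \<open>m \<otimes> da\<^sub>1 \<and> \<dots> \<and> da\<^sub>k\<close> span the chains, so the boundary is determined by its values on them.\<close>

definition is_poisson_boundary ::
    "('r::comm_complex_algebra \<Rightarrow> 'r \<Rightarrow> 'r) \<Rightarrow> ('r \<Rightarrow> 'r \<Rightarrow> 'r) \<Rightarrow> ('r chains \<Rightarrow> 'r chains) \<Rightarrow> bool"
  where "is_poisson_boundary pb mb D \<longleftrightarrow>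
    Vector_Spaces.linear chains_cscale chains_cscale D \<and>
    (\<forall>m as. D (m \<otimes> dwedge as) =
      (\<Sum>i<length as. chains_scale ((-1) ^ i) (mb m (as ! i) \<otimes> dwedge (nths as (- {i})))) +
      (\<Sum>j<length as. \<Sum>i<j. chains_scale ((-1) ^ (i + j))
         (m \<otimes> dwedge (pb (as ! i) (as ! j) # nths as (- {i, j})))))"

definition poisson_boundary ::
    "('r::comm_complex_algebra \<Rightarrow> 'r \<Rightarrow> 'r) \<Rightarrow> ('r \<Rightarrow> 'r \<Rightarrow> 'r) \<Rightarrow> 'r chains \<Rightarrow> 'r chains"
  where "poisson_boundary pb mb = (THE D. is_poisson_boundary pb mb D)"

definition poisson_cycles ::
    "('r::comm_complex_algebra \<Rightarrow> 'r \<Rightarrow> 'r) \<Rightarrow> ('r \<Rightarrow> 'r \<Rightarrow> 'r) \<Rightarrow> nat \<Rightarrow> 'r chains set"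
  where "poisson_cycles pb mb k = {z \<in> k_chains k. poisson_boundary pb mb z = 0}"

definition poisson_boundaries ::
    "('r::comm_complex_algebra \<Rightarrow> 'r \<Rightarrow> 'r) \<Rightarrow> ('r \<Rightarrow> 'r \<Rightarrow> 'r) \<Rightarrow> nat \<Rightarrow> 'r chains set"
  where "poisson_boundaries pb mb k = poisson_boundary pb mb ` k_chains (Suc k)"

definition homologous ::
    "('r::comm_complex_algebra \<Rightarrow> 'r \<Rightarrow> 'r) \<Rightarrow> ('r \<Rightarrow> 'r \<Rightarrow> 'r) \<Rightarrow> nat \<Rightarrow> ('r chains \<times> 'r chains) set"
  where "homologous pb mb k =
    {(x, y). x \<in> poisson_cycles pb mb k \<and> y \<in> poisson_cycles pb mb k \<and> x - y \<in> poisson_boundaries pb mb k}"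

text \<open>The quotient space of cycles modulo boundaries, as a set of cosets. Its linear combinations are
  taken on representatives.\<close>

definition poisson_homology ::
    "('r::comm_complex_algebra \<Rightarrow> 'r \<Rightarrow> 'r) \<Rightarrow> ('r \<Rightarrow> 'r \<Rightarrow> 'r) \<Rightarrow> nat \<Rightarrow> 'r chains set set"
  where "poisson_homology pb mb k = poisson_cycles pb mb k // homologous pb mb k"

definition homology_class ::
    "('r::comm_complex_algebra \<Rightarrow> 'r \<Rightarrow> 'r) \<Rightarrow> ('r \<Rightarrow> 'r \<Rightarrow> 'r) \<Rightarrow> nat \<Rightarrow> 'r chains \<Rightarrow> 'r chains set"
  where "homology_class pb mb k z = homologous pb mb k `` {z}"


section \<open>Polynomials in finitely many variables\<close>

type_synonym 'n cpoly = "('n \<Rightarrow>\<^sub>0 nat) \<Rightarrow>\<^sub>0 complex"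

definition X :: "'n \<Rightarrow> 'n cpoly"
  where "X i = Poly_Mapping.single (Poly_Mapping.single i 1) 1"

definition zero_one_exponents :: "('n::finite \<Rightarrow>\<^sub>0 nat) set"
  where "zero_one_exponents = {\<beta>. \<forall>i. Poly_Mapping.lookup \<beta> i \<in> {0, 1}}"

definition total_degree :: "('n::finite \<Rightarrow>\<^sub>0 nat) \<Rightarrow> nat"
  where "total_degree \<beta> = (\<Sum>i\<in>UNIV. Poly_Mapping.lookup \<beta> i)"

text \<open>\<open>X\<^sup>\<alpha> dX\<^sup>\<beta>\<close>\<close>

definition monomial_form :: "('n::{finite,linorder} \<Rightarrow>\<^sub>0 nat) \<Rightarrow> ('n \<Rightarrow>\<^sub>0 nat) \<Rightarrow> 'n cpoly chains"
  where "monomial_form \<alpha> \<beta> =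
    (\<Prod>i\<in>UNIV. X i ^ Poly_Mapping.lookup \<alpha> i) \<otimes>
    dwedge (map X (sorted_list_of_set {i. Poly_Mapping.lookup \<beta> i = 1}))"

definition exponent_set :: "int^'n^'n::finite \<Rightarrow> ('n \<Rightarrow>\<^sub>0 nat) set"
  where "exponent_set A = {\<gamma>. \<forall>i. Poly_Mapping.lookup \<gamma> i = 0 \<or>
    (\<Sum>j\<in>UNIV. A $ i $ j * (int (Poly_Mapping.lookup \<gamma> j) - 1)) = 0}"

definition basis_indices :: "int^'n^'n::finite \<Rightarrow> nat \<Rightarrow> (('n \<Rightarrow>\<^sub>0 nat) \<times> ('n \<Rightarrow>\<^sub>0 nat)) set"
  where "basis_indices A k =
    {(\<alpha>, \<beta>). \<beta> \<in> zero_one_exponents \<and> total_degree \<beta> = k \<and> \<alpha> + \<beta> \<in> exponent_set A}"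

end

theory Submission
  imports Defs
begin

text \<open>The differentials \<open>dX\<^sub>i\<close> form a basis of the Kaehler differentials of a polynomial ring, so the
  chains are the free module on the \<open>dX\<^sup>\<beta>\<close>. Grading them by giving \<open>X\<^sup>\<alpha> dX\<^sup>\<beta>\<close> the degree
  \<open>\<gamma> = \<alpha> + \<beta>\<close>, the boundary is homogeneous and acts in degree \<open>\<gamma>\<close> by the contraction
  \<open>dX\<^sub>i \<mapsto> - \<lambda>\<^sub>i X\<^sub>i\<close> with \<open>\<lambda>\<^sub>i = \<Sum>\<^sub>j a\<^sub>i\<^sub>j (\<gamma>\<^sub>j - 1)\<close>: the twist of the external bracket by the row sums
  of \<open>A\<close> is what shifts \<open>\<gamma>\<^sub>j\<close> by one. So the degree \<open>\<gamma>\<close> part is a Koszul complex, which has zero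
  boundary if \<open>\<gamma> \<in> C\<close> and is contractible otherwise.

  The boundary formula on arbitrary \<open>da\<^sub>1 \<and> \<dots> \<and> da\<^sub>k\<close> is obtained from Cartan's formula
  \<open>\<partial> (da \<and> \<omega>) + da \<and> \<partial> \<omega> = L\<^sub>a \<omega>\<close>, with \<open>L\<^sub>a\<close> the Lie action of \<open>a\<close>.\<close>

section \<open>Exterior multiplication and contraction\<close>

text \<open>Forms and chains are quotients of free modules, in which no element is visibly nonzero.
  The coordinate maps into families indexed by sets of variables supply the linear independence that
  the relations hide, and they turn all later identities into identities between operators on such
  families. The other obstacle is that \<open>poisson_boundary\<close> is a definite description: it
  says nothing until some C-linear map is known to satisfy the formula for all a_1, ..., a_k and not
  only for variables. In Cartan's formula, L_a supplies the terms in which a takes part and the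
  boundary of the remaining wedge supplies the others, which makes it the induction step over the
  list. The weight depends on alpha + beta alone because d{X_i, X_j} = a_ij (X_i dX_j + X_j dX_i):
  besides the exponents of the coefficient, every dX_j that is present contributes one more a_ij.
  The homotopy divides by lambda_s with s depending on the degree, so it is defined degree by degree
  and reassembled; finiteness of supports has to be checked there.\<close>

definition wedge_sign :: "'n::linorder \<Rightarrow> 'n set \<Rightarrow> 'r::comm_ring_1"
  where "wedge_sign i S = (-1) ^ card {j \<in> S. j < i}"

text \<open>The entry at S is the coefficient of dX_S, factors in increasing order. Moving dX_i from
  the front to its place passes the indices of S below i, hence \<open>wedge_sign\<close>; the count
  is strict, so S and S - {i} give the same sign.\<close>

definition ext_mult :: "'n \<Rightarrow> 'r::comm_ring_1 ^ 'n set \<Rightarrow> 'r ^ ('n::{finite,linorder}) set"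
  where "ext_mult i f = (\<chi> S. if i \<in> S then wedge_sign i S * f $ (S - {i}) else 0)"

text \<open>Interior product with the i-th coordinate vector field: dX_i is moved to the front and
  then dropped.\<close>

definition contract :: "'n \<Rightarrow> 'r::comm_ring_1 ^ 'n set \<Rightarrow> 'r ^ ('n::{finite,linorder}) set"
  where "contract i f = (\<chi> S. if i \<in> S then 0 else wedge_sign i S * f $ insert i S)"

lemma wedge_sign_insert:
  fixes S :: "'n::{finite,linorder} set"
  assumes "j \<notin> S"
  shows "wedge_sign i (insert j S) = (if j < i then - 1 else 1) * wedge_sign i S"
proof (cases "j < i")
  case True
  then have "{k \<in> insert j S. k < i} = insert j {k \<in> S. k < i}" by auto
  with True assms show ?thesis by (simp add: wedge_sign_def)
next
  case False
  then have "{k \<in> insert j S. k < i} = {k \<in> S. k < i}" by auto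
  with False show ?thesis by (simp add: wedge_sign_def)
qed

lemma wedge_sign_remove:
  fixes S :: "'n::{finite,linorder} set"
  assumes "j \<in> S"
  shows "wedge_sign i (S - {j}) = (if j < i then - 1 else 1) * (wedge_sign i S :: 'r::comm_ring_1)"
proof -
  have "wedge_sign i S = (if j < i then - 1 else 1) * (wedge_sign i (S - {j}) :: 'r)"
    using wedge_sign_insert[of j "S - {j}" i] assms by (simp add: insert_absorb)
  then show ?thesis by simp
qed

lemma wedge_sign_square [simp]: "wedge_sign i S * wedge_sign i S = 1"
  by (simp add: wedge_sign_def flip: power_mult_distrib)

lemma wedge_sign_square' [simp]: "wedge_sign i S * (wedge_sign i S * x) = x"
  by (simp flip: mult.assoc)

lemma ext_mult_add: "ext_mult i (f + g) = ext_mult i f + ext_mult i g"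
  by (simp add: ext_mult_def vec_eq_iff algebra_simps)

lemma ext_mult_scale: "ext_mult i (r *s f) = r *s ext_mult i f"
  by (simp add: ext_mult_def vec_eq_iff algebra_simps)

lemma contract_add: "contract i (f + g) = contract i f + contract i g"
  by (simp add: contract_def vec_eq_iff algebra_simps)

lemma contract_scale: "contract i (r *s f) = r *s contract i f"
  by (simp add: contract_def vec_eq_iff algebra_simps)

lemma additive_ext_mult: "additive (ext_mult i)"
  by (rule additive.intro) (rule ext_mult_add)

lemma additive_contract: "additive (contract i)"
  by (rule additive.intro) (rule contract_add)

lemma ext_mult_self [simp]: "ext_mult i (ext_mult i f) = 0"
  by (simp add: ext_mult_def vec_eq_iff)

text \<open>Both orders reach the same set S - {i, j}, and exactly one of them picks up an extra
  sign, since exactly one of i < j and j < i holds.\<close>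

lemma ext_mult_anticommute:
  "ext_mult i (ext_mult j f) + ext_mult j (ext_mult i f) = 0"
proof (cases "i = j")
  case False
  have "(ext_mult i (ext_mult j f) + ext_mult j (ext_mult i f)) $ S = 0" for S
  proof (cases "i \<in> S \<and> j \<in> S")
    case True
    define T where "T = S - {i, j}"
    have T: "S - {i} - {j} = T" "S - {j} - {i} = T" by (auto simp: T_def)
    from True False have "i < j \<and> \<not> j < i \<or> j < i \<and> \<not> i < j" by auto
    with True False show ?thesis
      by (elim disjE) (simp_all add: ext_mult_def wedge_sign_remove T)
  qed (auto simp: ext_mult_def)
  then show ?thesis by (simp add: vec_eq_iff)
qed simp

text \<open>Clifford relation. For i = j exactly one term survives, according to whether i lies in
  S; for distinct indices exactly one of the two products acquires an extra sign. Both Cartan's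
  formula and the Koszul homotopy rest on this.\<close>

lemma contract_ext_mult:
  fixes f :: "'r::comm_ring_1 ^ ('n::{finite,linorder}) set"
  shows "contract i (ext_mult j f) + ext_mult j (contract i f) = (if i = j then f else 0)"
proof -
  have "(contract i (ext_mult j f) + ext_mult j (contract i f)) $ S = (if i = j then f else 0) $ S" for S
  proof (cases "i = j")
    case True
    show ?thesis
    proof (cases "i \<in> S")
      case True
      then have "insert i (S - {i}) = S" by auto
      with True \<open>i = j\<close> show ?thesis
        by (simp add: ext_mult_def contract_def wedge_sign_remove del: insert_Diff_single)
    next
      case False
      with \<open>i = j\<close> show ?thesis
        by (auto simp: ext_mult_def contract_def wedge_sign_insert)
    qed
  next
    case False
    show ?thesis
    proof (cases "i \<notin> S \<and> j \<in> S")
      case True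
      with False show ?thesis
        by (cases "i < j")
          (auto simp: ext_mult_def contract_def wedge_sign_remove wedge_sign_insert insert_Diff_if)
    qed (use False in \<open>auto simp: ext_mult_def contract_def\<close>)
  qed
  then show ?thesis by (simp add: vec_eq_iff)
qed

section \<open>Exterior multiplication by one-forms\<close>

definition wedge_vec :: "'r::comm_ring_1 ^ 'n::{finite,linorder} \<Rightarrow> 'r ^ 'n set \<Rightarrow> 'r ^ ('n::{finite,linorder}) set"
  where "wedge_vec v f = (\<Sum>i\<in>UNIV. v $ i *s ext_mult i f)"

lemma wedge_vec_add_left: "wedge_vec (v + w) f = wedge_vec v f + wedge_vec w f"
  by (simp add: wedge_vec_def vector_sadd_rdistrib sum.distrib)

lemma vec_scale_sum: "r *s sum f I = (\<Sum>i\<in>I. r *s (f i :: 'r::comm_ring_1 ^ 'm))"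
  by (rule additive.sum) (simp add: additive_def vector_add_ldistrib)

lemma wedge_vec_scale_left: "wedge_vec (r *s v) f = r *s wedge_vec v f"
  by (simp add: wedge_vec_def vec_scale_sum vector_smult_assoc)

lemma wedge_vec_add: "wedge_vec v (f + g) = wedge_vec v f + wedge_vec v g"
  by (simp add: wedge_vec_def ext_mult_add vector_add_ldistrib sum.distrib)

lemma wedge_vec_scale: "wedge_vec v (r *s f) = r *s wedge_vec v f"
  by (simp add: wedge_vec_def ext_mult_scale vec_scale_sum vector_smult_assoc mult.commute)

lemma additive_wedge_vec: "additive (wedge_vec v)"
  by (rule additive.intro) (rule wedge_vec_add)

lemma wedge_vec_axis: "wedge_vec (axis i 1) f = ext_mult i f"
proof -
  have "axis i 1 $ j *s ext_mult j f = (if j = i then ext_mult i f else 0)" for j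
    by (simp add: axis_def)
  then show ?thesis by (simp add: wedge_vec_def)
qed

lemma wedge_vec_wedge_vec:
  "wedge_vec v (wedge_vec w f) = (\<Sum>i\<in>UNIV. \<Sum>j\<in>UNIV. (v $ i * w $ j) *s ext_mult i (ext_mult j f))"
  by (simp add: wedge_vec_def additive.sum[OF additive_ext_mult] ext_mult_scale vec_scale_sum
      vector_smult_assoc)

lemma wedge_vec_anticommute: "wedge_vec v (wedge_vec w f) = - wedge_vec w (wedge_vec v f)"
proof -
  have "wedge_vec w (wedge_vec v f)
      = (\<Sum>i\<in>UNIV. \<Sum>j\<in>UNIV. (v $ i * w $ j) *s ext_mult j (ext_mult i f))"
    unfolding wedge_vec_wedge_vec by (subst sum.swap) (simp add: mult.commute)
  then have "wedge_vec v (wedge_vec w f) + wedge_vec w (wedge_vec v f) = 0"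
    by (simp add: wedge_vec_wedge_vec ext_mult_anticommute flip: sum.distrib vector_add_ldistrib)
  then show ?thesis by (simp add: eq_neg_iff_add_eq_0)
qed

text \<open>Anticommutation only shows that twice the value is zero, and a general ring has no
  division by two. So the double sum is cut into its diagonal, which vanishes, and the parts below
  and above it, which cancel.\<close>

lemma wedge_vec_self: "wedge_vec v (wedge_vec v f) = 0"
proof -
  have *: "(v $ i * v $ j) *s ext_mult i (ext_mult j f)
      = - ((v $ j * v $ i) *s ext_mult j (ext_mult i f))" for i j
    using ext_mult_anticommute[of i j f]
    by (simp add: mult.commute eq_neg_iff_add_eq_0 flip: vector_add_ldistrib)
  define t where "t i j = (v $ i * v $ j) *s ext_mult i (ext_mult j f)" for i j
  have anti: "t i j = - t j i" for i j unfolding t_def by (rule *)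
  have diag: "t i i = 0" for i by (simp add: t_def)
  have split: "(\<Sum>j\<in>UNIV. t i j) = (\<Sum>j\<in>{j. j < i}. t i j) + (\<Sum>j\<in>{j. i < j}. t i j)" for i
  proof -
    have "UNIV = insert i ({j. j < i} \<union> {j. i < j})" by auto
    then have "(\<Sum>j\<in>UNIV. t i j) = t i i + (\<Sum>j\<in>{j. j < i} \<union> {j. i < j}. t i j)"
      by (metis (no_types, lifting) Un_iff finite less_irrefl mem_Collect_eq sum.insert)
    also have "(\<Sum>j\<in>{j. j < i} \<union> {j. i < j}. t i j)
        = (\<Sum>j\<in>{j. j < i}. t i j) + (\<Sum>j\<in>{j. i < j}. t i j)"
      by (rule sum.union_disjoint) auto
    finally show ?thesis by (simp add: diag)
  qed
  have "(\<Sum>i\<in>UNIV. \<Sum>j\<in>{j. j < i}. t i j) = (\<Sum>j\<in>UNIV. \<Sum>i\<in>{i. j < i}. t i j)"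
    using sum.swap_restrict[of UNIV UNIV t "\<lambda>i j. j < i"] by simp
  also have "\<dots> = - (\<Sum>j\<in>UNIV. \<Sum>i\<in>{i. j < i}. t j i)"
    by (subst anti) (simp add: sum_negf)
  finally show ?thesis
    unfolding wedge_vec_wedge_vec t_def[symmetric] split sum.distrib by simp
qed


lemma contract_wedge_vec:
  "contract i (wedge_vec v f) + wedge_vec v (contract i f) = v $ i *s f"
proof -
  have "contract i (wedge_vec v f) + wedge_vec v (contract i f)
      = (\<Sum>j\<in>UNIV. v $ j *s (contract i (ext_mult j f) + ext_mult j (contract i f)))"
    by (simp add: wedge_vec_def additive.sum[OF additive_contract] contract_scale
        vector_add_ldistrib sum.distrib)
  also have "\<dots> = (\<Sum>j\<in>UNIV. if j = i then v $ i *s f else 0)"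
    by (rule sum.cong) (auto simp: contract_ext_mult)
  finally show ?thesis by simp
qed


text \<open>On the unit \<open>axis {} 1\<close> this is the exterior product of the list. Keeping
  the last argument free allows a product to be split at any position.\<close>

definition wedge_list :: "('r::comm_ring_1 ^ 'n::{finite,linorder}) list \<Rightarrow> 'r ^ 'n set \<Rightarrow> 'r ^ ('n::{finite,linorder}) set"
  where "wedge_list vs f = foldr wedge_vec vs f"

lemma wedge_list_simps [simp]:
  "wedge_list [] f = f"
  "wedge_list (v # vs) f = wedge_vec v (wedge_list vs f)"
  "wedge_list (us @ vs) f = wedge_list us (wedge_list vs f)"
  by (simp_all add: wedge_list_def)

lemma wedge_list_add: "wedge_list vs (f + g) = wedge_list vs f + wedge_list vs g"
  by (induction vs) (simp_all add: wedge_vec_add)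

lemma wedge_list_scale: "wedge_list vs (r *s f) = r *s wedge_list vs f"
  by (induction vs) (simp_all add: wedge_vec_scale)

lemma additive_wedge_list: "additive (wedge_list vs)"
  by (rule additive.intro) (rule wedge_list_add)

lemmas wedge_vec_zero [simp] = additive.zero[OF additive_wedge_vec]
lemmas wedge_list_zero [simp] = additive.zero[OF additive_wedge_list]

lemma wedge_vec_wedge_list:
  "wedge_vec v (wedge_list vs f) = (-1) ^ length vs *s wedge_list vs (wedge_vec v f)"
proof (induction vs)
  case (Cons w vs)
  show ?case
    by (simp add: wedge_vec_anticommute[of v] Cons.IH wedge_vec_scale vector_smult_lneg)
qed simp

text \<open>Up to sign, \<open>wedge_vec_wedge_list\<close> moves the first v next to the second
  one.\<close>

lemma wedge_list_repeated: "wedge_list (us @ v # vs @ v # ws) f = 0"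
  using wedge_vec_wedge_list[of v vs "wedge_vec v (wedge_list ws f)"] by (simp add: wedge_vec_self)


section \<open>Coordinates of differential forms and chains over a polynomial ring\<close>

lemma poly_mapping_induct_single [case_names single add]:
  fixes p :: "'a \<Rightarrow>\<^sub>0 'b::comm_monoid_add"
  assumes single: "\<And>k v. P (Poly_Mapping.single k v)" and add: "\<And>p q. P p \<Longrightarrow> P q \<Longrightarrow> P (p + q)"
  shows "P p"
proof (induction p rule: update_induct)
  case const
  show ?case using single[of undefined 0] by simp
next
  case (update f a b)
  have "Poly_Mapping.update a b f = Poly_Mapping.single a b + f"
    using update(1)
    by (intro poly_mapping_eqI) (auto simp: lookup_update lookup_add lookup_single when_def in_keys_iff)
  then show ?case using update single add by simp
qed

section \<open>Linear maps out of free modules and their quotients\<close>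

definition free_lift :: "('g \<Rightarrow> 'r::comm_ring_1 ^ 'm) \<Rightarrow> ('g \<Rightarrow>\<^sub>0 'r) \<Rightarrow> 'r ^ 'm"
  where "free_lift \<phi> x = (\<Sum>g\<in>Poly_Mapping.keys x. Poly_Mapping.lookup x g *s \<phi> g)"

lemma free_lift_superset:
  assumes "finite K" "Poly_Mapping.keys x \<subseteq> K"
  shows "free_lift \<phi> x = (\<Sum>g\<in>K. Poly_Mapping.lookup x g *s \<phi> g)"
  unfolding free_lift_def using assms
  by (intro sum.mono_neutral_left) (auto simp: in_keys_iff)

lemma free_lift_add: "free_lift \<phi> (x + y) = free_lift \<phi> x + free_lift \<phi> y"
proof -
  let ?K = "Poly_Mapping.keys x \<union> Poly_Mapping.keys y"
  have "Poly_Mapping.keys (x + y) \<subseteq> ?K" by (rule Poly_Mapping.keys_add)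
  then show ?thesis
    by (simp add: free_lift_superset[of ?K] lookup_add vector_sadd_rdistrib sum.distrib)
qed

lemma free_lift_fscale: "free_lift \<phi> (fscale r x) = r *s free_lift \<phi> x"
proof -
  have "Poly_Mapping.keys (fscale r x) \<subseteq> Poly_Mapping.keys x" by (auto simp: in_keys_iff)
  then show ?thesis
    by (simp add: free_lift_superset[of "Poly_Mapping.keys x"] vec_scale_sum vector_smult_assoc)
qed

lemma additive_free_lift: "additive (free_lift \<phi>)"
  by (rule additive.intro) (rule free_lift_add)

lemma free_lift_single [simp]: "free_lift \<phi> (Poly_Mapping.single g r) = r *s \<phi> g"
  by (simp add: free_lift_def)

text \<open>Universal property of a module given by relations; the three coordinate maps below are
  well defined by it.\<close>

lemma free_lift_cong_mod:
  assumes "\<And>x. x \<in> S \<Longrightarrow> free_lift \<phi> x = 0" and "cong_mod S x y"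
  shows "free_lift \<phi> x = free_lift \<phi> y"
proof -
  have "free_lift \<phi> z = 0" if "z \<in> free.span S" for z
    using that
    by (induction rule: free.span_induct_alt)
      (simp_all add: additive.zero[OF additive_free_lift] free_lift_add free_lift_fscale assms(1))
  with assms(2) have "free_lift \<phi> (x - y) = 0" by (simp add: cong_mod_def)
  then show ?thesis by (simp add: additive.diff[OF additive_free_lift])
qed

subsection \<open>Partial derivatives\<close>

lift_definition partial_deriv :: "'n \<Rightarrow> 'n cpoly \<Rightarrow> 'n cpoly"
  is "\<lambda>i p \<alpha>. of_nat (Poly_Mapping.lookup \<alpha> i + 1) * p (\<alpha> + Poly_Mapping.single i 1)"
proof -
  fix i :: 'n and p :: "('n \<Rightarrow>\<^sub>0 nat) \<Rightarrow> complex"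
  assume "finite {\<alpha>. p \<alpha> \<noteq> 0}"
  then have "finite ((\<lambda>\<alpha>. \<alpha> + Poly_Mapping.single i 1) -` {\<alpha>. p \<alpha> \<noteq> 0})"
    by (rule finite_vimageI) (simp add: inj_def)
  then show "finite {\<alpha>. of_nat (Poly_Mapping.lookup \<alpha> i + 1) * p (\<alpha> + Poly_Mapping.single i 1) \<noteq> 0}"
    by (rule finite_subset[rotated]) auto
qed

lemma lookup_partial_deriv:
  "Poly_Mapping.lookup (partial_deriv i p) \<alpha> =
    of_nat (Poly_Mapping.lookup \<alpha> i + 1) * Poly_Mapping.lookup p (\<alpha> + Poly_Mapping.single i 1)"
  by transfer rule

lemma partial_deriv_add: "partial_deriv i (p + q) = partial_deriv i p + partial_deriv i q"
  by (intro poly_mapping_eqI) (simp add: lookup_partial_deriv lookup_add ring_distribs)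

lemma minus_single_add_single:
  assumes "Poly_Mapping.lookup \<alpha> i \<noteq> (0::nat)"
  shows "\<alpha> - Poly_Mapping.single i 1 + Poly_Mapping.single i 1 = \<alpha>"
  using assms by (intro poly_mapping_eqI) (auto simp: lookup_add lookup_minus lookup_single when_def)

lemma partial_deriv_single:
  "partial_deriv i (Poly_Mapping.single \<alpha> c) =
    Poly_Mapping.single (\<alpha> - Poly_Mapping.single i 1) (of_nat (Poly_Mapping.lookup \<alpha> i) * c)"
proof (rule poly_mapping_eqI)
  fix \<beta>
  have "\<alpha> = \<beta> + Poly_Mapping.single i 1 \<longleftrightarrow>
      \<alpha> - Poly_Mapping.single i 1 = \<beta> \<and> Poly_Mapping.lookup \<alpha> i \<noteq> 0"
    using minus_single_add_single[of \<alpha> i] by (auto simp: lookup_add lookup_single)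
  moreover have "Poly_Mapping.lookup \<beta> i + 1 = Poly_Mapping.lookup \<alpha> i"
    if "\<alpha> = \<beta> + Poly_Mapping.single i 1"
    using that by (simp add: lookup_add)
  ultimately show "Poly_Mapping.lookup (partial_deriv i (Poly_Mapping.single \<alpha> c)) \<beta> =
      Poly_Mapping.lookup (Poly_Mapping.single (\<alpha> - Poly_Mapping.single i 1)
        (of_nat (Poly_Mapping.lookup \<alpha> i) * c)) \<beta>"
    by (cases "\<alpha> = \<beta> + Poly_Mapping.single i 1") (auto simp: lookup_partial_deriv lookup_single when_def)
qed

lemma partial_deriv_mult:
  "partial_deriv i (p * q) = p * partial_deriv i q + q * partial_deriv i p"
proof (induction p rule: poly_mapping_induct_single)
  case (single \<alpha> c)
  show ?case
  proof (induction q rule: poly_mapping_induct_single)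
    case (single \<beta> d)
    \<comment> \<open>Subtraction of exponents truncates at 0, so the identity may fail if the i-th
      exponent is 0; then the coefficient \<open>of_nat 0\<close> removes the term anyway.\<close>
    have *: "\<alpha> + (\<beta> - Poly_Mapping.single i 1) = \<alpha> + \<beta> - Poly_Mapping.single i 1"
      if "Poly_Mapping.lookup \<beta> i \<noteq> 0" for \<alpha> \<beta> :: "'a \<Rightarrow>\<^sub>0 nat"
      using that
      by (intro poly_mapping_eqI) (auto simp: lookup_add lookup_minus lookup_single when_def)
    have "Poly_Mapping.single (\<alpha> + (\<beta> - Poly_Mapping.single i 1)) (c * (of_nat (Poly_Mapping.lookup \<beta> i) * d))
        = Poly_Mapping.single (\<alpha> + \<beta> - Poly_Mapping.single i 1) (c * (of_nat (Poly_Mapping.lookup \<beta> i) * d))"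
      using *[of \<beta> \<alpha>] by (cases "Poly_Mapping.lookup \<beta> i = 0") auto
    moreover have "Poly_Mapping.single (\<beta> + (\<alpha> - Poly_Mapping.single i 1)) (d * (of_nat (Poly_Mapping.lookup \<alpha> i) * c))
        = Poly_Mapping.single (\<alpha> + \<beta> - Poly_Mapping.single i 1) (d * (of_nat (Poly_Mapping.lookup \<alpha> i) * c))"
      using *[of \<alpha> \<beta>] by (cases "Poly_Mapping.lookup \<alpha> i = 0") (auto simp: add.commute)
    ultimately show ?case
      by (simp add: mult_single partial_deriv_single lookup_add algebra_simps flip: single_add)
  qed (simp add: partial_deriv_add algebra_simps)
qed (simp add: partial_deriv_add algebra_simps)

lemma of_cx_cpoly: "(of_cx c :: 'n cpoly) = Poly_Mapping.single 0 c"
  by (simp add: of_cx_poly_mapping_def of_cx_complex_def)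

lemma partial_deriv_of_cx: "partial_deriv i (of_cx c) = 0"
  by (simp add: of_cx_cpoly partial_deriv_single)

lemma partial_deriv_X: "partial_deriv i (X j) = (if i = j then 1 else 0)"
  by (auto simp: X_def partial_deriv_single lookup_single single_one)

definition gradient :: "'n cpoly \<Rightarrow> 'n cpoly ^ 'n::finite"
  where "gradient p = (\<chi> i. partial_deriv i p)"

lemma gradient_add: "gradient (p + q) = gradient p + gradient q"
  by (simp add: gradient_def vec_eq_iff partial_deriv_add)

lemma gradient_mult: "gradient (p * q) = p *s gradient q + q *s gradient p"
  by (simp add: gradient_def vec_eq_iff partial_deriv_mult)

lemma gradient_of_cx [simp]: "gradient (of_cx c) = 0"
  by (simp add: gradient_def vec_eq_iff partial_deriv_of_cx)

lemma gradient_X [simp]: "gradient (X i) = axis i 1"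
  by (simp add: gradient_def axis_def partial_deriv_X vec_eq_iff)

subsection \<open>The coordinate maps\<close>

text \<open>The gradient is a C-linear derivation, so its R-linear extension kills the relations.
  The result lists the coordinates with respect to the dX_i.\<close>

lift_definition kaehler_coord :: "'n::finite cpoly kaehler \<Rightarrow> 'n cpoly ^ 'n" is "free_lift gradient"
proof (rule free_lift_cong_mod)
  fix z :: "'n cpoly \<Rightarrow>\<^sub>0 'n cpoly"
  assume "z \<in> kaehler_relations"
  then show "free_lift gradient z = 0"
    by (auto simp: kaehler_relations_def additive.diff[OF additive_free_lift] free_lift_fscale
        gradient_add gradient_mult)
qed

lemma kaehler_coord_add: "kaehler_coord (x + y) = kaehler_coord x + kaehler_coord y"
  by transfer (rule free_lift_add)

lemma kaehler_coord_scale: "kaehler_coord (kscale r x) = r *s kaehler_coord x"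
  by transfer (rule free_lift_fscale)

lemma kaehler_coord_kd [simp]: "kaehler_coord (kd p) = gradient p"
  by transfer simp

lift_definition forms_coord :: "'n::{finite,linorder} cpoly forms \<Rightarrow> 'n cpoly ^ 'n set"
  is "free_lift (\<lambda>ws. wedge_list (map kaehler_coord ws) (axis {} 1))"
proof (rule free_lift_cong_mod)
  fix z :: "'n cpoly kaehler list \<Rightarrow>\<^sub>0 'n cpoly"
  assume "z \<in> exterior_relations"
  then show "free_lift (\<lambda>ws. wedge_list (map kaehler_coord ws) (axis {} 1)) z = 0"
    by (auto simp: exterior_relations_def additive.diff[OF additive_free_lift] free_lift_fscale
        kaehler_coord_add kaehler_coord_scale wedge_vec_add_left wedge_vec_scale_left
        wedge_list_add wedge_list_scale wedge_list_repeated[simplified])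
qed

lemma forms_coord_add: "forms_coord (x + y) = forms_coord x + forms_coord y"
  by transfer (rule free_lift_add)

lemma forms_coord_scale: "forms_coord (forms_scale r x) = r *s forms_coord x"
  by transfer (rule free_lift_fscale)

lemma forms_coord_wedge: "forms_coord (wedge ws) = wedge_list (map kaehler_coord ws) (axis {} 1)"
  unfolding wedge_def by (simp add: forms_coord.abs_eq)

lemma forms_coord_dwedge: "forms_coord (dwedge as) = wedge_list (map gradient as) (axis {} 1)"
  by (simp add: dwedge_def forms_coord_wedge comp_def)

lift_definition chains_coord :: "'n::{finite,linorder} cpoly chains \<Rightarrow> 'n cpoly ^ 'n set"
  is "free_lift (\<lambda>(m, w). m *s forms_coord w)"
proof (rule free_lift_cong_mod)
  fix z :: "'n cpoly \<times> 'n cpoly forms \<Rightarrow>\<^sub>0 'n cpoly"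
  assume "z \<in> tensor_relations"
  then show "free_lift (\<lambda>(m, w). m *s forms_coord w) z = 0"
    by (auto simp: tensor_relations_def additive.diff[OF additive_free_lift] free_lift_fscale
        forms_coord_add forms_coord_scale vector_sadd_rdistrib vector_add_ldistrib
        vector_smult_assoc mult.commute)
qed

lemma chains_coord_add: "chains_coord (x + y) = chains_coord x + chains_coord y"
  by transfer (rule free_lift_add)

lemma chains_coord_scale: "chains_coord (chains_scale r x) = r *s chains_coord x"
  by transfer (rule free_lift_fscale)

lemma chains_coord_tensor: "chains_coord (m \<otimes> w) = m *s forms_coord w"
  unfolding tensor_def by (simp add: chains_coord.abs_eq)

lemma additive_chains_coord: "additive chains_coord"
  by (rule additive.intro) (rule chains_coord_add)


subsection \<open>Bases of differential forms and chains\<close>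

text \<open>Induction over the algebra structure instead of monomials: an identity whose two sides
  obey the same product rule then needs checking only on constants and variables.\<close>

lemma cpoly_induct [case_names const X add mult]:
  fixes p :: "'n cpoly"
  assumes const: "\<And>c. P (of_cx c)" and X: "\<And>i. P (X i)"
    and add: "\<And>p q. P p \<Longrightarrow> P q \<Longrightarrow> P (p + q)" and mult: "\<And>p q. P p \<Longrightarrow> P q \<Longrightarrow> P (p * q)"
  shows "P p"
proof (induction p rule: poly_mapping_induct_single)
  case (single \<alpha> c)
  have "P (Poly_Mapping.single \<alpha> 1)"
  proof (induction \<alpha> rule: poly_mapping_induct_single)
    case (single i k)
    show ?case
    proof (induction k)
      case 0
      show ?case using const[of 1] by (simp add: of_cx_cpoly)
    next
      case (Suc k)
      have "Poly_Mapping.single (Poly_Mapping.single i (Suc k)) 1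
          = X i * Poly_Mapping.single (Poly_Mapping.single i k) 1"
        by (simp add: X_def mult_single flip: single_add)
      then show ?case using mult[OF X Suc] by simp
    qed
  next
    case (add \<alpha> \<beta>)
    then show ?case using mult[OF add] by (simp add: mult_single)
  qed
  from mult[OF const[of c] this] show ?case by (simp add: of_cx_cpoly mult_single)
qed (rule add)

section \<open>Relations in the quotients and spanning sets\<close>

lemma kd_add: "kd (p + q) = kd p + kd q"
proof (transfer, unfold cong_mod_def)
  fix p q :: 'a
  show "Poly_Mapping.single (p + q) 1 - (Poly_Mapping.single p 1 + Poly_Mapping.single q 1)
      \<in> free.span (kaehler_relations :: ('a \<Rightarrow>\<^sub>0 'a) set)"
    by (rule free.span_base) (auto simp: kaehler_relations_def diff_diff_eq)
qed

lemma kd_cscale: "kd (of_cx c * p) = kscale (of_cx c) (kd p)"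
proof (transfer, unfold cong_mod_def)
  fix c and p :: 'a
  show "Poly_Mapping.single (of_cx c * p) 1 - fscale (of_cx c) (Poly_Mapping.single p 1)
      \<in> free.span (kaehler_relations :: ('a \<Rightarrow>\<^sub>0 'a) set)"
    by (rule free.span_base) (auto simp: kaehler_relations_def)
qed

lemma kd_mult: "kd (p * q) = kscale p (kd q) + kscale q (kd p)"
proof (transfer, unfold cong_mod_def)
  fix p q :: 'a
  show "Poly_Mapping.single (p * q) 1
      - (fscale p (Poly_Mapping.single q 1) + fscale q (Poly_Mapping.single p 1))
      \<in> free.span (kaehler_relations :: ('a \<Rightarrow>\<^sub>0 'a) set)"
    by (rule free.span_base) (auto simp: kaehler_relations_def diff_diff_eq)
qed

lemma kd_of_cx: "kd (of_cx c) = 0"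
proof -
  have "kd 1 = kd 1 + kd (1 :: 'a)" using kd_mult[of 1 "1 :: 'a"] by simp
  then show ?thesis using kd_cscale[of c "1 :: 'a"] by simp
qed

lemma wedge_add: "wedge (us @ (x + y) # vs) = wedge (us @ x # vs) + wedge (us @ y # vs)"
  unfolding wedge_def plus_forms.abs_eq forms.abs_eq_iff cong_mod_def
  by (rule free.span_base) (unfold exterior_relations_def Let_def diff_diff_eq[symmetric], blast)

lemma wedge_scale: "wedge (us @ kscale r x # vs) = forms_scale r (wedge (us @ x # vs))"
  unfolding wedge_def forms_scale.abs_eq forms.abs_eq_iff cong_mod_def
  by (rule free.span_base) (unfold exterior_relations_def Let_def, blast)

lemma wedge_repeated: "wedge (us @ x # vs @ x # ws) = 0"
  unfolding wedge_def zero_forms_def forms.abs_eq_iff cong_mod_def diff_0_right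
  by (rule free.span_base) (unfold exterior_relations_def Let_def, blast)

lemma tensor_scale_left: "(m * r) \<otimes> w = chains_scale r (m \<otimes> w)"
  unfolding tensor_def chains_scale.abs_eq chains.abs_eq_iff cong_mod_def
  by (rule free.span_base) (unfold tensor_relations_def Let_def, blast)

lemma tensor_scale_right: "m \<otimes> forms_scale r w = chains_scale r (m \<otimes> w)"
  unfolding tensor_def chains_scale.abs_eq chains.abs_eq_iff cong_mod_def
  by (rule free.span_base) (unfold tensor_relations_def Let_def, blast)

lemma tensor_add_right: "m \<otimes> (w + w') = m \<otimes> w + m \<otimes> w'"
  unfolding tensor_def plus_chains.abs_eq chains.abs_eq_iff cong_mod_def
  by (rule free.span_base) (unfold tensor_relations_def Let_def diff_diff_eq[symmetric], blast)

lemma single_eq_fscale: "Poly_Mapping.single g r = fscale r (Poly_Mapping.single g 1)"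
  by (intro poly_mapping_eqI) (simp add: lookup_single when_def)

lemma kaehler_span_kd: "x \<in> kaehler.span (range kd)"
proof (induction x rule: kaehler.abs_induct)
  case (1 p)
  show ?case
  proof (induction p rule: poly_mapping_induct_single)
    case (single g r)
    have "abs_kaehler (Poly_Mapping.single g r) = kscale r (kd g)"
      by (subst single_eq_fscale) (simp add: kscale.abs_eq kd.abs_eq)
    then show ?case by (simp add: kaehler.span_scale kaehler.span_base)
  qed (simp add: kaehler.span_add flip: plus_kaehler.abs_eq)
qed

lemma forms_span_wedge: "x \<in> forms.span (range wedge)"
proof (induction x rule: forms.abs_induct)
  case (1 p)
  show ?case
  proof (induction p rule: poly_mapping_induct_single)
    case (single g r)
    have "abs_forms (Poly_Mapping.single g r) = forms_scale r (wedge g)"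
      by (subst single_eq_fscale) (simp add: forms_scale.abs_eq wedge_def)
    then show ?case by (simp add: forms.span_scale forms.span_base)
  qed (simp add: forms.span_add flip: plus_forms.abs_eq)
qed

lemma chains_span_tensor: "x \<in> chains.span {m \<otimes> w | m w. True}"
proof (induction x rule: chains.abs_induct)
  case (1 p)
  show ?case
  proof (induction p rule: poly_mapping_induct_single)
    case (single g r)
    have "abs_chains (Poly_Mapping.single g r) = chains_scale r (fst g \<otimes> snd g)"
      by (subst single_eq_fscale) (simp add: chains_scale.abs_eq tensor_def)
    moreover have "fst g \<otimes> snd g \<in> {m \<otimes> w | m w. True}" by blast
    ultimately show ?case by (simp only: chains.span_scale chains.span_base)
  qed (simp add: chains.span_add flip: plus_chains.abs_eq)
qed

lemma kaehler_span_X: "x \<in> kaehler.span (range (\<lambda>i. kd (X i)))" for x :: "'n cpoly kaehler"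
proof -
  have "kd p \<in> kaehler.span (range (\<lambda>i. kd (X i)))" for p :: "'n cpoly"
    by (induction p rule: cpoly_induct)
      (auto simp: kd_of_cx kd_add kd_mult intro: kaehler.span_add kaehler.span_scale
        kaehler.span_base kaehler.span_zero)
  then have "kaehler.span (range kd) \<subseteq> kaehler.span (range (\<lambda>i. kd (X i) :: 'n cpoly kaehler))"
    by (intro kaehler.span_minimal) auto
  then show ?thesis using kaehler_span_kd by blast
qed

lemma wedge_swap: "wedge (us @ x # y # vs) = - wedge (us @ y # x # vs)"
proof -
  have "wedge (us @ (x + y) # (x + y) # vs) = 0"
    using wedge_repeated[of us "x + y" "[]" vs] by simp
  moreover have "wedge (us @ (x + y) # (x + y) # vs) =
      wedge (us @ x # x # vs) + wedge (us @ x # y # vs)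
      + (wedge (us @ y # x # vs) + wedge (us @ y # y # vs))"
    using wedge_add[of "us @ [x]" x y vs] wedge_add[of "us @ [y]" x y vs]
    by (simp add: wedge_add)
  ultimately show ?thesis
    using wedge_repeated[of us x "[]" vs] wedge_repeated[of us y "[]" vs]
    by (simp add: eq_neg_iff_add_eq_0)
qed

abbreviation dX_set :: "'n::{finite,linorder} set \<Rightarrow> 'n cpoly forms"
  where "dX_set S \<equiv> dwedge (map X (sorted_list_of_set S))"

text \<open>Insertion sort by adjacent swaps. Membership up to sign suffices because spans are
  closed under negation, and the prefix \<open>us\<close> lets the induction run behind factors
  already fixed.\<close>

lemma dX_list_sort:
  "wedge (us @ map (\<lambda>i. kd (X i)) is) \<in>
    {wedge (us @ map (\<lambda>i. kd (X i)) (sort is)), - wedge (us @ map (\<lambda>i. kd (X i)) (sort is))}"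
proof -
  have insort: "wedge (us @ map (\<lambda>i. kd (X i)) (i # is)) \<in>
    {wedge (us @ map (\<lambda>i. kd (X i)) (insort i is)), - wedge (us @ map (\<lambda>i. kd (X i)) (insort i is))}"
    for us i "is"
  proof (induction "is" arbitrary: us)
    case (Cons j "is")
    show ?case
      using Cons.IH[of "us @ [kd (X j)]"] wedge_swap[of us "kd (X i)" "kd (X j)"] by auto
  qed simp
  show ?thesis
  proof (induction "is" arbitrary: us)
    case (Cons i "is")
    show ?case
      using Cons.IH[of "us @ [kd (X i)]"] insort[of us i "sort is"] by auto
  qed simp
qed

lemma dX_list_in_span:
  "wedge (map (\<lambda>i. kd (X i)) is) \<in> forms.span (dX_set ` {S. card S = length is})"
proof (cases "distinct is")
  case True
  have "dX_set (set is) \<in> forms.span (dX_set ` {S. card S = length is})"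
    using True by (intro forms.span_base imageI) (simp add: distinct_card)
  moreover have "sorted_list_of_set (set is) = sort is"
    using True by (simp add: sorted_list_of_set_sort_remdups distinct_remdups_id)
  ultimately show ?thesis
    using dX_list_sort[of "[]" "is"] forms.span_neg by (auto simp: dwedge_def comp_def)
next
  case False
  then obtain xs ys zs y where "is = xs @ [y] @ ys @ [y] @ zs"
    using not_distinct_decomp by blast
  then show ?thesis by (simp add: wedge_repeated forms.span_zero)
qed

lemma wedge_in_span: "wedge ws \<in> forms.span (dX_set ` {S. card S = length ws})"
proof -
  \<comment> \<open>Factors are expanded in the dX_i from left to right; \<open>is\<close> records
    the variables chosen for the factors already treated and therefore has to vary in the
    induction.\<close>
  have "wedge (map (\<lambda>i. kd (X i)) is @ ws)
      \<in> forms.span (dX_set ` {S. card S = length is + length ws})" for "is"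
  proof (induction ws arbitrary: "is")
    case Nil
    show ?case using dX_list_in_span[of "is"] by simp
  next
    case (Cons w ws)
    have "w \<in> kaehler.span (range (\<lambda>i. kd (X i)))" by (rule kaehler_span_X)
    then show ?case
    proof (induction rule: kaehler.span_induct_alt)
      case base
      \<comment> \<open>Writing zero as \<open>kscale 0 0\<close> brings it under the scaling
        relation.\<close>
      have "wedge (map (\<lambda>i. kd (X i)) is @ kscale 0 0 # ws) = 0"
        unfolding wedge_scale by simp
      then show ?case by (simp add: forms.span_zero)
    next
      case (step r v y)
      then obtain i where v: "v = kd (X i)" by auto
      have "wedge (map (\<lambda>i. kd (X i)) is @ v # ws)
          \<in> forms.span (dX_set ` {S. card S = length is + length (w # ws)})"
        using Cons.IH[of "is @ [i]"] by (simp add: v)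
      with step show ?case
        by (simp add: wedge_add wedge_scale forms.span_add forms.span_scale)
    qed
  qed
  from this[of "[]"] show ?thesis by simp
qed

lemma chains_span_basis: "x \<in> chains.span (range (\<lambda>S. 1 \<otimes> dX_set S))"
proof -
  have "1 \<otimes> w \<in> chains.span (range (\<lambda>S. 1 \<otimes> dX_set S))" for w :: "'a cpoly forms"
  proof -
    have "range wedge \<subseteq> forms.span (range (dX_set :: 'a set \<Rightarrow> _))"
      using wedge_in_span forms.span_mono[of "dX_set ` _" "range dX_set"] by blast
    then have "w \<in> forms.span (range dX_set)"
      using forms_span_wedge[of w] forms.span_minimal[OF _ forms.subspace_span] by blast
    then show ?thesis
    proof (induction rule: forms.span_induct_alt)
      case base
      have "1 \<otimes> forms_scale 0 0 = (0 :: 'a cpoly chains)" unfolding tensor_scale_right by simp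
      then show ?case by (simp add: chains.span_zero)
    next
      case (step r v y)
      then show ?case
        by (auto simp: tensor_add_right tensor_scale_right
            intro!: chains.span_add chains.span_scale intro: chains.span_base)
    qed
  qed
  then have "m \<otimes> w \<in> chains.span (range (\<lambda>S. 1 \<otimes> dX_set S))" for m and w :: "'a cpoly forms"
    using tensor_scale_left[of 1 m w] by (simp add: chains.span_scale)
  then have "{m \<otimes> w | m w. True} \<subseteq> chains.span (range (\<lambda>S. 1 \<otimes> dX_set (S :: 'a set)))"
    by blast
  then have "chains.span {m \<otimes> w | m w. True} \<subseteq> chains.span (range (\<lambda>S. 1 \<otimes> dX_set (S :: 'a set)))"
    by (rule chains.span_minimal) (rule chains.subspace_span)
  then show ?thesis
    using chains_span_tensor by (rule subsetD)
qed

lemma forms_coord_dX_set: "forms_coord (dX_set S) = axis S 1"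
proof -
  have "sorted is \<Longrightarrow> distinct is \<Longrightarrow>
      wedge_list (map (gradient \<circ> X) is) (axis {} 1) = axis (set is) 1" for "is" :: "'a list"
  proof (induction "is")
    case (Cons i "is")
    \<comment> \<open>The head of a sorted list is its least index, so it enters without a
      sign.\<close>
    then have no_less: "{j \<in> set (i # is). j < i} = {}" by auto
    have "wedge_sign i (set (i # is)) = (1 :: 'a cpoly)" unfolding wedge_sign_def no_less by simp
    then have "ext_mult i (axis (set is) 1) $ T = (axis (set (i # is)) 1 :: 'a cpoly ^ 'a set) $ T" for T
      using Cons.prems by (auto simp: ext_mult_def axis_def)
    then have "ext_mult i (axis (set is) 1) = (axis (set (i # is)) 1 :: 'a cpoly ^ 'a set)"
      by (intro vec_eq_iff[THEN iffD2] allI)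
    then show ?case using Cons by (simp add: wedge_vec_axis)
  qed simp
  from this[of "sorted_list_of_set S"] show ?thesis by (simp add: forms_coord_dwedge)
qed

section \<open>The coordinate isomorphism for chains\<close>

definition chains_of_coord :: "'n cpoly ^ 'n set \<Rightarrow> 'n::{finite,linorder} cpoly chains"
  where "chains_of_coord f = (\<Sum>S\<in>UNIV. chains_scale (f $ S) (1 \<otimes> dX_set S))"

lemma chains_of_coord_add: "chains_of_coord (f + g) = chains_of_coord f + chains_of_coord g"
  by (simp add: chains_of_coord_def chains.scale_left_distrib sum.distrib)

lemma chains_of_coord_scale: "chains_of_coord (r *s f) = chains_scale r (chains_of_coord f)"
  by (simp add: chains_of_coord_def chains.scale_sum_right)

lemma additive_chains_of_coord: "additive chains_of_coord"
  by (rule additive.intro) (rule chains_of_coord_add)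

lemma chains_of_coord_axis: "chains_of_coord (axis S 1) = 1 \<otimes> dX_set S"
proof -
  have "chains_scale (axis S 1 $ T) (1 \<otimes> dX_set T) = (if T = S then 1 \<otimes> dX_set S else 0)" for T
    by (auto simp: axis_def)
  then show ?thesis by (simp add: chains_of_coord_def)
qed

text \<open>This half uses only that the \<open>1 \<otimes> dX_set S\<close> span; the converse
  \<open>chains_coord_of_coord\<close> expresses their linear independence.\<close>

lemma chains_of_coord_coord [simp]: "chains_of_coord (chains_coord x) = x"
proof -
  have "x \<in> chains.span (range (\<lambda>S. 1 \<otimes> dX_set S))" by (rule chains_span_basis)
  then show ?thesis
    by (induction rule: chains.span_induct_alt)
      (auto simp: additive.zero[OF additive_chains_coord] additive.zero[OF additive_chains_of_coord]
        chains_coord_add chains_of_coord_add chains_coord_scale chains_of_coord_scale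
        chains_coord_tensor forms_coord_dX_set chains_of_coord_axis)
qed

lemma chains_coord_of_coord [simp]: "chains_coord (chains_of_coord f) = f"
proof -
  have "f $ S * axis S 1 $ T = (if S = T then f $ T else 0)" for S T
    by (simp add: axis_def)
  then show ?thesis
    by (simp add: chains_of_coord_def additive.sum[OF additive_chains_coord] chains_coord_scale
        chains_coord_tensor forms_coord_dX_set vec_eq_iff)
qed

lemma inj_chains_coord: "chains_coord x = chains_coord y \<longleftrightarrow> x = y"
  by (metis chains_of_coord_coord)

lemma wedge_list_degree:
  assumes "\<And>S. card S \<noteq> d \<Longrightarrow> f $ S = 0" and "card S \<noteq> length vs + d"
  shows "wedge_list vs f $ S = 0"
  using assms(2)
proof (induction vs arbitrary: S)
  case (Cons v vs)
  have "wedge_list vs f $ (S - {i}) = 0" if "i \<in> S" for i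
  proof -
    have "card S = Suc (card (S - {i}))" using that by (intro card.remove) simp_all
    with Cons.prems have "card (S - {i}) \<noteq> length vs + d" by (metis add_Suc length_Cons)
    then show ?thesis by (rule Cons.IH)
  qed
  then show ?case by (auto simp: wedge_vec_def ext_mult_def intro!: sum.neutral)
qed (simp add: assms(1))

lemma k_chains_iff: "x \<in> k_chains k \<longleftrightarrow> (\<forall>S. card S \<noteq> k \<longrightarrow> chains_coord x $ S = 0)"
proof
  have forms: "forms_coord w $ S = 0" if "w \<in> k_forms k" "card S \<noteq> k" for w and S :: "'a set"
    using that(1) unfolding k_forms_def
  proof (induction rule: forms.span_induct_alt)
    case base
    show ?case using forms_coord_scale[of 0 "0 :: 'a cpoly forms"] by simp
  next
    case (step r v y)
    then obtain ws where "v = wedge ws" "length ws = k" by auto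
    with that(2) have "forms_coord v $ S = 0"
      by (auto simp: forms_coord_wedge axis_def intro!: wedge_list_degree[where d = 0])
    with step show ?case by (simp add: forms_coord_add forms_coord_scale)
  qed
  assume x: "x \<in> k_chains k"
  show "\<forall>S. card S \<noteq> k \<longrightarrow> chains_coord x $ S = 0"
    using x unfolding k_chains_def
    by (induction rule: chains.span_induct_alt)
      (auto simp: additive.zero[OF additive_chains_coord] chains_coord_add chains_coord_scale
        chains_coord_tensor forms)
next
  assume *: "\<forall>S. card S \<noteq> k \<longrightarrow> chains_coord x $ S = 0"
  have "chains_scale (chains_coord x $ S) (1 \<otimes> dX_set S) \<in> k_chains k" for S
  proof (cases "card S = k")
    case True
    then have "dX_set S \<in> k_forms k"
      unfolding k_forms_def dwedge_def by (intro forms.span_base) auto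
    then show ?thesis unfolding k_chains_def by (intro chains.span_scale chains.span_base) auto
  next
    case False
    with * show ?thesis by (simp add: k_chains_def chains.span_zero)
  qed
  then have "chains_of_coord (chains_coord x) \<in> k_chains k"
    unfolding chains_of_coord_def k_chains_def by (intro chains.span_sum) auto
  then show "x \<in> k_chains k" by simp
qed


section \<open>The boundary operator in coordinates\<close>

lemma nths_Cons_Compl:
  "nths (a # as) (- {0}) = as"
  "nths (a # as) (- {Suc i}) = a # nths as (- {i})"
  "nths (a # as) (- {0, Suc j}) = nths as (- {j})"
  "nths (a # as) (- {Suc i, Suc j}) = a # nths as (- {i, j})"
proof -
  have "{k. Suc k \<in> - {0}} = UNIV" "{k. Suc k \<in> - {Suc i}} = - {i}"
    "{k. Suc k \<in> - {0, Suc j}} = - {j}" "{k. Suc k \<in> - {Suc i, Suc j}} = - {i, j}"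
    by auto
  then show
    "nths (a # as) (- {0}) = as"
    "nths (a # as) (- {Suc i}) = a # nths as (- {i})"
    "nths (a # as) (- {0, Suc j}) = nths as (- {j})"
    "nths (a # as) (- {Suc i, Suc j}) = a # nths as (- {i, j})"
    by (simp_all add: nths_Cons nths_all)
qed

lemma additive_gradient: "additive gradient"
  by (rule additive.intro) (rule gradient_add)

lemma gradient_of_int [simp]: "gradient (of_int c) = 0"
proof -
  have "(of_int c :: 'a cpoly) = of_cx (of_int c)"
    by (simp add: of_cx_cpoly)
  then show ?thesis by (simp only: gradient_of_cx)
qed

lemma ext_mult_contract: "ext_mult i (contract i f) $ S = (if i \<in> S then f $ S else 0)"
proof (cases "i \<in> S")
  case True
  then have "insert i (S - {i}) = S" by auto
  with True show ?thesis
    by (simp add: ext_mult_def contract_def wedge_sign_remove del: insert_Diff_single)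
qed (simp add: ext_mult_def)

locale log_poisson_module = poisson_module pb "(*)" mb
  for pb mb :: "'n::{finite,linorder} cpoly \<Rightarrow> 'n cpoly \<Rightarrow> 'n cpoly" +
  fixes A :: "int ^ 'n::{finite,linorder} ^ 'n::{finite,linorder}"
  assumes skew: "transpose A = - A"
    and pb_X: "pb (X i) (X j) = of_int (A $ i $ j) * X i * X j"
    and mb_X: "mb m (X i) = - pb (X i) m + of_int (\<Sum>l\<in>UNIV. A $ i $ l) * X i * m"
begin

lemma A_skew: "A $ i $ j = - A $ j $ i"
proof -
  have "transpose A $ j $ i = (- A) $ j $ i" by (simp only: skew)
  then show ?thesis by (simp only: transpose_def vec_lambda_beta vector_uminus_component)
qed

lemma A_diag [simp]: "A $ i $ i = 0"
  using A_skew[of i i] by linarith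

lemma pb_skew: "pb a b = - pb b a"
proof -
  have "pb (a + b) (a + b) = pb a a + pb a b + (pb b a + pb b b)"
    by (simp only: pb_add_left pb_add_right add_ac)
  then have "pb a b + pb b a = 0" by (simp add: pb_self)
  then show ?thesis by (simp add: eq_neg_iff_add_eq_0)
qed

lemma pb_leibniz_left: "pb (a * b) r = a * pb b r + b * pb a r"
  using pb_leibniz[of r a b] by (simp add: pb_skew[of _ r] algebra_simps)

lemma pb_of_cx_right [simp]: "pb r (of_cx c) = 0"
proof -
  have "pb r 1 = 0" using pb_leibniz[of r 1 1] by simp
  then show ?thesis using pb_cscale_right[of r c 1] by simp
qed

lemma pb_of_cx_left [simp]: "pb (of_cx c) r = 0"
  by (subst pb_skew) simp

lemma mb_of_cx [simp]: "mb m (of_cx c) = 0"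
proof -
  have "mb m 1 = 0" using mb_mult[of m 1 1] by simp
  then show ?thesis using mb_cscale_right[of m c 1] by simp
qed

text \<open>The axiom \<open>act_pb\<close> solved for its last term, with skewness absorbing the
  sign.\<close>

lemma mb_mult_left: "mb (r * m) a = r * mb m a + pb r a * m"
  using act_pb[of m a r] by (simp add: pb_skew[of a] algebra_simps)

lemma additive_mb: "additive (\<lambda>m. mb m a)"
  by (rule additive.intro) (rule mb_add_left)

lemmas mb_zero [simp] = additive.zero[OF additive_mb]

lemma mb_wedge_sign: "mb (wedge_sign i S * m) a = wedge_sign i S * mb m a"
proof -
  have "wedge_sign i S = (1 :: 'n cpoly) \<or> wedge_sign i S = (- 1 :: 'n cpoly)"
    unfolding wedge_sign_def by (cases "even (card {j \<in> S. j < i})") simp_all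
  then show ?thesis by (auto simp: additive.minus[OF additive_mb])
qed

text \<open>Bracketing with a is a derivation, hence a vector field determined by its values on the
  variables.\<close>

lemma pb_chain_rule: "(\<Sum>i\<in>UNIV. pb (X i) a * partial_deriv i b) = pb b a"
proof (induction b rule: cpoly_induct)
  case (const c)
  show ?case by (simp add: partial_deriv_of_cx)
next
  case (X j)
  have "pb (X i) a * partial_deriv i (X j) = (if i = j then pb (X j) a else 0)" for i
    by (simp add: partial_deriv_X)
  then show ?case by simp
next
  case (add p q)
  then show ?case by (simp add: partial_deriv_add pb_add_left distrib_left sum.distrib)
next
  case (mult p q)
  have "(\<Sum>i\<in>UNIV. pb (X i) a * partial_deriv i (p * q))
      = p * (\<Sum>i\<in>UNIV. pb (X i) a * partial_deriv i q)
        + q * (\<Sum>i\<in>UNIV. pb (X i) a * partial_deriv i p)"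
    by (simp add: partial_deriv_mult sum_distrib_left algebra_simps flip: sum.distrib)
  then show ?case by (simp add: mult pb_leibniz_left)
qed

section \<open>Cartan calculus for the boundary in coordinates\<close>

definition log_bracket :: "'n \<Rightarrow> 'n cpoly ^ 'n set \<Rightarrow> 'n cpoly ^ 'n set"
  where "log_bracket i f =
    (\<chi> S. mb (f $ S) (X i) - of_int (\<Sum>j\<in>S. A $ i $ j) * X i * f $ S)"

text \<open>In the boundary of m dX_S the summand a_ij X_i dX_j of d{X_i, X_j} restores dX_j and
  loses dX_i, while a_ij X_j dX_i does the opposite. Collecting by the lost index i, after sorting,
  leaves {m, X_i} minus the a_ij X_i m for j in S, which is \<open>log_bracket i\<close>.\<close>

definition coord_boundary :: "'n cpoly ^ 'n set \<Rightarrow> 'n cpoly ^ 'n set"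
  where "coord_boundary f = (\<Sum>i\<in>UNIV. contract i (log_bracket i f))"

text \<open>The Lie action of a: the bracket on coefficients plus the derivation of the exterior
  algebra that sends dX_i to d{X_i, a}.\<close>

definition lie_action :: "'n cpoly \<Rightarrow> 'n cpoly ^ 'n set \<Rightarrow> 'n cpoly ^ 'n set"
  where "lie_action a f = (\<chi> S. mb (f $ S) a)
    + (\<Sum>i\<in>UNIV. wedge_vec (gradient (pb (X i) a)) (contract i f))"

text \<open>Contraction with the Hamiltonian vector field of a. By
  \<open>coord_boundary_scale\<close> it measures how far the boundary is from being
  R-linear.\<close>

definition ham_contract :: "'n cpoly \<Rightarrow> 'n cpoly ^ 'n set \<Rightarrow> 'n cpoly ^ 'n set"
  where "ham_contract a f = (\<Sum>i\<in>UNIV. pb (X i) a *s contract i f)"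

lemma log_bracket_add: "log_bracket i (f + g) = log_bracket i f + log_bracket i g"
  by (simp add: log_bracket_def vec_eq_iff mb_add_left algebra_simps)

lemma coord_boundary_add: "coord_boundary (f + g) = coord_boundary f + coord_boundary g"
  by (simp add: coord_boundary_def log_bracket_add contract_add sum.distrib)

lemma additive_coord_boundary: "additive coord_boundary"
  by (rule additive.intro) (rule coord_boundary_add)

lemma log_bracket_scale: "log_bracket i (r *s f) = r *s log_bracket i f + pb r (X i) *s f"
  by (simp add: log_bracket_def vec_eq_iff mb_mult_left algebra_simps)

lemma coord_boundary_scale: "coord_boundary (r *s f) = r *s coord_boundary f - ham_contract r f"
proof -
  have "coord_boundary (r *s f)
      = r *s coord_boundary f + (\<Sum>i\<in>UNIV. pb r (X i) *s contract i f)"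
    by (simp add: coord_boundary_def log_bracket_scale contract_add contract_scale
        sum.distrib vec_scale_sum)
  also have "(\<Sum>i\<in>UNIV. pb r (X i) *s contract i f) = - ham_contract r f"
    unfolding ham_contract_def by (subst pb_skew) (simp add: vector_smult_lneg sum_negf)
  finally show ?thesis by simp
qed

lemma log_bracket_ext_mult:
  "log_bracket i (ext_mult l f) = ext_mult l (log_bracket i f) - (of_int (A $ i $ l) * X i) *s ext_mult l f"
proof -
  have "log_bracket i (ext_mult l f) $ S
      = (ext_mult l (log_bracket i f) - (of_int (A $ i $ l) * X i) *s ext_mult l f) $ S" for S
  proof (cases "l \<in> S")
    case True
    then have "(\<Sum>j\<in>S. A $ i $ j) = A $ i $ l + (\<Sum>j\<in>S - {l}. A $ i $ j)"
      by (simp add: sum.remove)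
    with True show ?thesis
      by (simp add: log_bracket_def ext_mult_def mb_wedge_sign algebra_simps del: of_int_sum)
  next
    case False
    then show ?thesis by (simp add: log_bracket_def ext_mult_def)
  qed
  then show ?thesis by (simp add: vec_eq_iff)
qed

text \<open>Expanding d{X_i, ab} also differentiates the factors a and b; these extra terms assemble
  to the two contractions.\<close>

lemma lie_action_mult:
  "lie_action (a * b) f = a *s lie_action b f + b *s lie_action a f
    + wedge_vec (gradient a) (ham_contract b f) + wedge_vec (gradient b) (ham_contract a f)"
proof -
  have "(\<chi> S. mb (f $ S) (a * b)) = a *s (\<chi> S. mb (f $ S) b) + b *s (\<chi> S. mb (f $ S) a)"
    by (simp add: vec_eq_iff mb_mult algebra_simps)
  then show ?thesis
    by (simp add: lie_action_def ham_contract_def pb_leibniz gradient_add gradient_mult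
        wedge_vec_add_left wedge_vec_scale_left wedge_vec_scale additive.sum[OF additive_wedge_vec]
        vec_scale_sum vector_add_ldistrib sum.distrib algebra_simps)
qed

lemma lie_action_add_left: "lie_action (a + b) f = lie_action a f + lie_action b f"
  by (simp add: lie_action_def mb_add_right pb_add_right gradient_add wedge_vec_add_left
      sum.distrib vec_eq_iff)

lemma wedge_vec_zero_left [simp]: "wedge_vec 0 f = 0"
  by (simp add: wedge_vec_def)

lemma lie_action_of_cx [simp]: "lie_action (of_cx c) f = 0"
proof -
  have "gradient 0 = (0 :: 'n cpoly ^ 'n::{finite,linorder})" by (rule additive.zero[OF additive_gradient])
  moreover have "(\<chi> S. 0) = (0 :: 'n cpoly ^ 'n set)" by (simp add: vec_eq_iff)
  ultimately show ?thesis by (simp add: lie_action_def)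
qed

lemma coord_boundary_ext_mult:
  "coord_boundary (ext_mult l f) + ext_mult l (coord_boundary f) = lie_action (X l) f"
proof -
  have contract_ext: "contract i (ext_mult l g) = (if i = l then g else 0) - ext_mult l (contract i g)"
    for i and g :: "'n cpoly ^ 'n set"
    using contract_ext_mult[of i l g] by (simp add: eq_diff_eq)
  let ?B = "\<lambda>i. of_int (A $ i $ l) * X i"
  have "contract i (log_bracket i (ext_mult l f))
      = (if i = l then log_bracket l f else 0) - ext_mult l (contract i (log_bracket i f))
        + ?B i *s ext_mult l (contract i f)" for i
    by (auto simp: log_bracket_ext_mult additive.diff[OF additive_contract] contract_ext
        contract_scale vector_ssub_ldistrib)
  then have "coord_boundary (ext_mult l f) + ext_mult l (coord_boundary f)
      = log_bracket l f + (\<Sum>i\<in>UNIV. ?B i *s ext_mult l (contract i f))"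
    by (simp add: coord_boundary_def additive.sum[OF additive_ext_mult] sum.distrib sum_subtractf)
  \<comment> \<open>\<open>ext_mult i\<close> after \<open>contract i\<close> projects onto the sets
    containing i, so the row sum over S becomes the X_l dX_i half of d{X_i, X_l}. The X_i dX_l half
    is the sum over \<open>?B\<close>.\<close>
  also have "log_bracket l f = (\<chi> S. mb (f $ S) (X l))
      + (\<Sum>i\<in>UNIV. (of_int (A $ i $ l) * X l) *s ext_mult i (contract i f))"
  proof -
    have "(\<Sum>i\<in>UNIV. of_int (A $ i $ l) * X l * (if i \<in> S then f $ S else 0))
        = - (of_int (\<Sum>j\<in>S. A $ l $ j) * X l * f $ S)" for S
    proof -
      have "(\<Sum>i\<in>UNIV. of_int (A $ i $ l) * X l * (if i \<in> S then f $ S else 0))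
          = (\<Sum>i\<in>S. of_int (A $ i $ l) * X l * f $ S)"
        by (intro sum.mono_neutral_cong_right) auto
      also have "\<dots> = - (of_int (\<Sum>j\<in>S. A $ l $ j) * X l * f $ S)"
        by (subst A_skew) (simp add: sum_distrib_right sum_negf)
      finally show ?thesis .
    qed
    then show ?thesis by (simp add: log_bracket_def vec_eq_iff ext_mult_contract)
  qed
  also have "\<dots> + (\<Sum>i\<in>UNIV. ?B i *s ext_mult l (contract i f)) = lie_action (X l) f"
    by (simp add: lie_action_def pb_X gradient_mult wedge_vec_add_left
        wedge_vec_scale_left wedge_vec_axis vector_add_ldistrib vector_smult_assoc sum.distrib
        algebra_simps)
  finally show ?thesis .
qed

lemma ham_contract_wedge_vec:
  "ham_contract a (wedge_vec (gradient b) f) + wedge_vec (gradient b) (ham_contract a f) = pb b a *s f"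
proof -
  have "ham_contract a (wedge_vec (gradient b) f) + wedge_vec (gradient b) (ham_contract a f)
      = (\<Sum>i\<in>UNIV. pb (X i) a *s (contract i (wedge_vec (gradient b) f)
          + wedge_vec (gradient b) (contract i f)))"
    by (simp add: ham_contract_def additive.sum[OF additive_wedge_vec] wedge_vec_scale
        vector_add_ldistrib sum.distrib)
  also have "\<dots> = (\<Sum>i\<in>UNIV. pb (X i) a * partial_deriv i b) *s f"
    unfolding contract_wedge_vec
    by (simp add: vec_eq_iff gradient_def sum_distrib_right mult.assoc)
  finally show ?thesis by (simp add: pb_chain_rule)
qed

text \<open>Both sides obey the same product rule in \<open>a\<close>, so that the variables suffice.\<close>

lemma coord_boundary_wedge_vec:
  "coord_boundary (wedge_vec (gradient a) f) + wedge_vec (gradient a) (coord_boundary f) = lie_action a f"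
proof (induction a arbitrary: f rule: cpoly_induct)
  case (const c)
  show ?case by (simp add: additive.zero[OF additive_coord_boundary])
next
  case (X i)
  show ?case by (simp add: wedge_vec_axis coord_boundary_ext_mult)
next
  case (add p q)
  then show ?case
    by (simp add: gradient_add wedge_vec_add_left coord_boundary_add lie_action_add_left algebra_simps)
next
  case (mult p q)
  let ?P = "wedge_vec (gradient p)" and ?Q = "wedge_vec (gradient q)"
  have "coord_boundary (wedge_vec (gradient (p * q)) f) + wedge_vec (gradient (p * q)) (coord_boundary f)
      = p *s (coord_boundary (?Q f) + ?Q (coord_boundary f))
        + q *s (coord_boundary (?P f) + ?P (coord_boundary f))
        - ham_contract p (?Q f) - ham_contract q (?P f)"
    by (simp add: gradient_mult wedge_vec_add_left wedge_vec_scale_left coord_boundary_add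
        coord_boundary_scale vector_add_ldistrib)
  also have "\<dots> = p *s lie_action q f + q *s lie_action p f
        - ham_contract p (?Q f) - ham_contract q (?P f)"
    by (simp only: mult)
  also have "ham_contract p (?Q f) = pb q p *s f - ?Q (ham_contract p f)"
    using ham_contract_wedge_vec[of p q f] by (simp add: eq_diff_eq)
  also have "ham_contract q (?P f) = pb p q *s f - ?P (ham_contract q f)"
    using ham_contract_wedge_vec[of q p f] by (simp add: eq_diff_eq)
  \<comment> \<open>By skewness the two scalar multiples of f left by the contractions
    cancel.\<close>
  also have "pb q p = - pb p q" by (rule pb_skew)
  finally show ?case by (simp add: lie_action_mult vector_smult_lneg)
qed

lemma lie_action_add: "lie_action a (f + g) = lie_action a f + lie_action a g"
  by (simp add: lie_action_def mb_add_left contract_add wedge_vec_add sum.distrib vec_eq_iff)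

lemma lie_action_scale: "lie_action a (r *s f) = r *s lie_action a f + pb r a *s f"
  by (simp add: lie_action_def mb_mult_left contract_scale wedge_vec_scale sum_distrib_left
      vec_eq_iff algebra_simps)

text \<open>On variables this is how \<open>lie_action\<close> is built; the Leibniz rule in b
  carries it to all exact one-forms.\<close>

lemma lie_action_wedge_vec:
  "lie_action a (wedge_vec (gradient b) f)
    = wedge_vec (gradient b) (lie_action a f) + wedge_vec (gradient (pb b a)) f"
proof (induction b arbitrary: f rule: cpoly_induct)
  case (const c)
  have "lie_action a 0 = 0" using lie_action_add[of a 0 0] by simp
  then show ?case by (simp add: additive.zero[OF additive_gradient])
next
  case (X l)
  have mb_part: "(\<chi> S. mb (ext_mult l f $ S) a) = ext_mult l (\<chi> S. mb (f $ S) a)"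
    by (simp add: vec_eq_iff ext_mult_def mb_wedge_sign)
  have "wedge_vec (gradient (pb (X i) a)) (contract i (ext_mult l f))
      = (if i = l then wedge_vec (gradient (pb (X l) a)) f else 0)
        + ext_mult l (wedge_vec (gradient (pb (X i) a)) (contract i f))" for i
  proof -
    have "contract i (ext_mult l f) = (if i = l then f else 0) - ext_mult l (contract i f)"
      using contract_ext_mult[of i l f] by (simp add: eq_diff_eq)
    then show ?thesis
      using wedge_vec_anticommute[of "axis l 1" "gradient (pb (X i) a)" "contract i f"]
      by (simp add: additive.diff[OF additive_wedge_vec] wedge_vec_axis)
  qed
  then show ?case
    by (simp add: lie_action_def wedge_vec_axis mb_part ext_mult_add sum.distrib
        additive.sum[OF additive_ext_mult])
next
  case (add p q)
  then show ?case
    by (simp add: gradient_add wedge_vec_add_left lie_action_add pb_add_left)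
next
  case (mult p q)
  then show ?case
    by (simp add: gradient_add gradient_mult wedge_vec_add_left wedge_vec_scale_left lie_action_add
        lie_action_scale pb_leibniz_left vector_add_ldistrib)
qed

abbreviation gradient_wedge :: "'n cpoly list \<Rightarrow> 'n cpoly ^ 'n set"
  where "gradient_wedge as \<equiv> wedge_list (map gradient as) (axis {} 1)"

text \<open>L_a replaces one factor da_j by d{a_j, a}, and bringing that to the front costs (-1)^j.
  On the unit all contractions vanish, so only the bracket on m remains.\<close>

lemma lie_action_gradient_wedge:
  "lie_action a (m *s gradient_wedge as) = mb m a *s gradient_wedge as
    + (\<Sum>j<length as. ((-1) ^ j * m) *s
        wedge_vec (gradient (pb (as ! j) a)) (gradient_wedge (nths as (- {j}))))"
proof (induction "as")
  case Nil
  have "lie_action a (m *s axis {} 1) $ S = (mb m a *s axis {} 1) $ S" for S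
  proof -
    have "contract i (m *s axis {} 1) = (0 :: 'n cpoly ^ 'n set)" for i
      by (simp add: contract_def axis_def vec_eq_iff)
    then show ?thesis by (simp add: lie_action_def axis_def)
  qed
  then show ?case by (simp add: vec_eq_iff)
next
  case (Cons b "as")
  have "lie_action a (m *s gradient_wedge (b # as))
      = wedge_vec (gradient b) (lie_action a (m *s gradient_wedge as))
        + wedge_vec (gradient (pb b a)) (m *s gradient_wedge as)"
    by (simp add: lie_action_wedge_vec flip: wedge_vec_scale)
  also have "wedge_vec (gradient b) (lie_action a (m *s gradient_wedge as))
      = mb m a *s gradient_wedge (b # as)
        + (\<Sum>j<length as. ((-1) ^ j * m) *s wedge_vec (gradient b)
            (wedge_vec (gradient (pb (as ! j) a)) (gradient_wedge (nths as (- {j})))))"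
    by (simp add: Cons.IH wedge_vec_add additive.sum[OF additive_wedge_vec] wedge_vec_scale)
  also have "\<dots> + wedge_vec (gradient (pb b a)) (m *s gradient_wedge as)
      = mb m a *s gradient_wedge (b # as) + (\<Sum>j<length (b # as). ((-1) ^ j * m) *s
          wedge_vec (gradient (pb ((b # as) ! j) a)) (gradient_wedge (nths (b # as) (- {j}))))"
    \<comment> \<open>Position 0 is split off. The others move up by one, and that sign change
      matches the swap with db.\<close>
    unfolding list.size(4) add_0_right add_Suc_right sum.lessThan_Suc_shift
    by (simp add: nths_Cons_Compl wedge_vec_scale vector_smult_lneg vector_smult_rneg sum_negf
        wedge_vec_anticommute[of "gradient b"])
  finally show ?case .
qed

text \<open>In the Cartan step, L_a yields the term of position 0 and the pairs (0, j), with d{a_j,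
  a} = - d{a, a_j} fixing their signs; the boundary of the tail yields all the others, shifted by
  one.\<close>

lemma coord_boundary_gradient_wedge:
  "coord_boundary (m *s gradient_wedge as) =
    (\<Sum>i<length as. ((-1) ^ i * mb m (as ! i)) *s gradient_wedge (nths as (- {i}))) +
    (\<Sum>j<length as. \<Sum>i<j. ((-1) ^ (i + j) * m) *s
      gradient_wedge (pb (as ! i) (as ! j) # nths as (- {i, j})))"
proof (induction "as")
  case Nil
  have "contract i (log_bracket i (m *s axis {} 1)) = 0" for i
    by (simp add: contract_def axis_def log_bracket_def vec_eq_iff)
  then show ?case by (simp add: coord_boundary_def)
next
  case (Cons a "as")
  have gradient_neg: "gradient (pb b a) = - gradient (pb a b)" for b
    by (subst pb_skew) (rule additive.minus[OF additive_gradient])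
  have wedge_neg: "wedge_vec (- v) f = - wedge_vec v f" for v :: "'n cpoly ^ 'n::{finite,linorder}" and f
    by (simp add: wedge_vec_def vector_smult_lneg sum_negf)
  have "coord_boundary (m *s gradient_wedge (a # as))
      = lie_action a (m *s gradient_wedge as)
        - wedge_vec (gradient a) (coord_boundary (m *s gradient_wedge as))"
    using coord_boundary_wedge_vec[of a "m *s gradient_wedge as"]
    by (simp add: wedge_vec_scale eq_diff_eq)
  also have "\<dots> = (\<Sum>i<length (a # as). ((-1) ^ i * mb m ((a # as) ! i)) *s
        gradient_wedge (nths (a # as) (- {i}))) +
      (\<Sum>j<length (a # as). \<Sum>i<j. ((-1) ^ (i + j) * m) *s
        gradient_wedge (pb ((a # as) ! i) ((a # as) ! j) # nths (a # as) (- {i, j})))"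
    unfolding list.size(4) add_0_right add_Suc_right sum.lessThan_Suc_shift
    by (simp add: Cons.IH lie_action_gradient_wedge nths_Cons_Compl wedge_vec_scale
        additive.sum[OF additive_wedge_vec] wedge_vec_add gradient_neg wedge_neg
        wedge_vec_anticommute[of "gradient a"] vector_smult_lneg vector_smult_rneg
        sum_negf sum.distrib sum_subtractf)
  finally show ?case .
qed

text \<open>The definite description needs existence, which is
  \<open>coord_boundary_gradient_wedge\<close> for arbitrary lists, and uniqueness, for which lists
  of variables suffice.\<close>

lemma poisson_boundary_coord:
  "poisson_boundary pb mb x = chains_of_coord (coord_boundary (chains_coord x))"
proof -
  let ?D = "\<lambda>x. chains_of_coord (coord_boundary (chains_coord x))"
  have "Vector_Spaces.linear chains_cscale chains_cscale ?D"
  proof (unfold_locales)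
    fix x y :: "'n cpoly chains" and c
    show "?D (x + y) = ?D x + ?D y"
      by (simp add: chains_coord_add coord_boundary_add chains_of_coord_add)
    show "?D (chains_cscale c x) = chains_cscale c (?D x)"
      by (simp add: chains_cscale_def chains_coord_scale coord_boundary_scale ham_contract_def
          chains_of_coord_scale)
  qed
  moreover have "?D (m \<otimes> dwedge as) =
      (\<Sum>i<length as. chains_scale ((-1) ^ i) (mb m (as ! i) \<otimes> dwedge (nths as (- {i})))) +
      (\<Sum>j<length as. \<Sum>i<j. chains_scale ((-1) ^ (i + j))
         (m \<otimes> dwedge (pb (as ! i) (as ! j) # nths as (- {i, j}))))" for m "as"
  proof -
    have "chains_coord (?D (m \<otimes> dwedge as)) = chains_coord (
      (\<Sum>i<length as. chains_scale ((-1) ^ i) (mb m (as ! i) \<otimes> dwedge (nths as (- {i})))) +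
      (\<Sum>j<length as. \<Sum>i<j. chains_scale ((-1) ^ (i + j))
         (m \<otimes> dwedge (pb (as ! i) (as ! j) # nths as (- {i, j})))))"
      by (simp add: chains_coord_tensor forms_coord_dwedge coord_boundary_gradient_wedge
          chains_coord_add additive.sum[OF additive_chains_coord] chains_coord_scale
          vector_smult_assoc)
    then show ?thesis by (simp only: inj_chains_coord)
  qed
  ultimately have D: "is_poisson_boundary pb mb ?D"
    unfolding is_poisson_boundary_def by blast
  have "poisson_boundary pb mb = ?D"
    unfolding poisson_boundary_def
  proof (rule the_equality)
    show "is_poisson_boundary pb mb ?D" by (rule D)
  next
    fix D' assume D': "is_poisson_boundary pb mb D'"
    then interpret D': Vector_Spaces.linear chains_cscale chains_cscale D'
      by (simp add: is_poisson_boundary_def)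
    from D interpret D: Vector_Spaces.linear chains_cscale chains_cscale ?D
      by (simp add: is_poisson_boundary_def)
    have eq: "D' (m \<otimes> dwedge as) = ?D (m \<otimes> dwedge as)" for m "as"
      using D D' by (simp add: is_poisson_boundary_def)
    show "D' = ?D"
    proof
      fix x :: "'n cpoly chains"
      \<comment> \<open>A competitor D' is only C-linear, so polynomial coefficients are first
        absorbed into the tensor; afterwards additivity is enough.\<close>
      have tensor: "chains_scale m (1 \<otimes> w) = m \<otimes> w" for m and w :: "'n cpoly forms"
        using tensor_scale_left[of 1 m w] by simp
      have "x = (\<Sum>S\<in>UNIV. chains_coord x $ S \<otimes> dX_set S)"
        using chains_of_coord_coord[of x, symmetric] by (simp only: chains_of_coord_def tensor)
      then show "D' x = ?D x"
        using D'.sum[of "\<lambda>S. chains_coord x $ S \<otimes> dX_set S" UNIV]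
          D.sum[of "\<lambda>S. chains_coord x $ S \<otimes> dX_set S" UNIV] eq by simp
    qed
  qed
  then show ?thesis by simp
qed

end


section \<open>Homogeneous components\<close>

lift_definition set_exponent :: "'n::finite set \<Rightarrow> 'n \<Rightarrow>\<^sub>0 nat" is "\<lambda>S i. if i \<in> S then 1 else 0"
  by simp

lemma lookup_set_exponent: "Poly_Mapping.lookup (set_exponent S) i = (if i \<in> S then 1 else 0)"
  by transfer simp

text \<open>Says that the truncated difference of \<gamma> and \<open>set_exponent S\<close> is a
  true difference, so that dX_S occurs in degree \<gamma>.\<close>

definition covers :: "('n \<Rightarrow>\<^sub>0 nat) \<Rightarrow> 'n set \<Rightarrow> bool"
  where "covers \<gamma> S \<longleftrightarrow> (\<forall>i\<in>S. Poly_Mapping.lookup \<gamma> i \<noteq> 0)"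

lemma covers_add [simp]: "covers (\<alpha> + set_exponent S) S"
  by (simp add: covers_def lookup_add lookup_set_exponent)

lemma covers_insert: "covers \<gamma> (insert i S) \<longleftrightarrow> Poly_Mapping.lookup \<gamma> i \<noteq> 0 \<and> covers \<gamma> S"
  by (auto simp: covers_def)

lemma covers_diff_add: "covers \<gamma> S \<Longrightarrow> \<gamma> - set_exponent S + set_exponent S = \<gamma>"
  by (intro poly_mapping_eqI) (auto simp: covers_def lookup_add lookup_minus lookup_set_exponent)

text \<open>The component of degree \<open>\<gamma>\<close> for the grading that gives \<open>X\<^sup>\<alpha> dX\<^sup>\<beta>\<close> the degree
  \<open>\<alpha> + \<beta>\<close>; this grading is preserved by the boundary.\<close>

definition component :: "'n cpoly ^ 'n set \<Rightarrow> ('n \<Rightarrow>\<^sub>0 nat) \<Rightarrow> complex ^ ('n::{finite,linorder}) set"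
  where "component f \<gamma> =
    (\<chi> S. if covers \<gamma> S then Poly_Mapping.lookup (f $ S) (\<gamma> - set_exponent S) else 0)"

lemma component_add: "component (f + g) \<gamma> = component f \<gamma> + component g \<gamma>"
  by (simp add: component_def vec_eq_iff lookup_add)

lemma additive_component: "additive (\<lambda>f. component f \<gamma>)"
  by (rule additive.intro) (rule component_add)

lemmas component_zero [simp] = additive.zero[OF additive_component]

lemma component_set_exponent: "component f (\<alpha> + set_exponent S) $ S = Poly_Mapping.lookup (f $ S) \<alpha>"
  by (simp add: component_def)

lemma component_eqI:
  assumes "\<And>\<gamma>. component f \<gamma> = component g \<gamma>"
  shows "f = g"
proof -
  have "f $ S = g $ S" for S
    by (intro poly_mapping_eqI) (simp add: assms flip: component_set_exponent)
  then show ?thesis by (simp add: vec_eq_iff)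
qed

lemma finite_component: "finite {\<gamma>. component f \<gamma> $ S \<noteq> 0}"
proof (rule finite_subset)
  show "{\<gamma>. component f \<gamma> $ S \<noteq> 0}
      \<subseteq> (\<lambda>\<alpha>. \<alpha> + set_exponent S) ` Poly_Mapping.keys (f $ S)"
  proof
    fix \<gamma> assume "\<gamma> \<in> {\<gamma>. component f \<gamma> $ S \<noteq> 0}"
    then have "covers \<gamma> S" "\<gamma> - set_exponent S \<in> Poly_Mapping.keys (f $ S)"
      by (auto simp: component_def in_keys_iff split: if_splits)
    then show "\<gamma> \<in> (\<lambda>\<alpha>. \<alpha> + set_exponent S) ` Poly_Mapping.keys (f $ S)"
      using covers_diff_add by (metis image_eqI)
  qed
qed simp

text \<open>Reassembles a family chosen independently in each degree; finiteness for each S is what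
  makes the entries polynomials.\<close>

lemma ex_component:
  fixes c :: "('n::{finite,linorder} \<Rightarrow>\<^sub>0 nat) \<Rightarrow> complex ^ 'n set"
  assumes "\<And>S. finite {\<gamma>. c \<gamma> $ S \<noteq> 0}" and "\<And>\<gamma> S. \<not> covers \<gamma> S \<Longrightarrow> c \<gamma> $ S = 0"
  obtains f where "\<And>\<gamma>. component f \<gamma> = c \<gamma>"
proof
  have "finite {\<alpha>. c (\<alpha> + set_exponent S) $ S \<noteq> 0}" for S
    using finite_vimageI[OF assms(1)[of S], of "\<lambda>\<alpha>. \<alpha> + set_exponent S"]
    by (simp add: inj_def vimage_def)
  then have "component (\<chi> S. Abs_poly_mapping (\<lambda>\<alpha>. c (\<alpha> + set_exponent S) $ S)) \<gamma> $ S = c \<gamma> $ S" for \<gamma> S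
    by (simp add: component_def assms(2) covers_diff_add)
  then show "component (\<chi> S. Abs_poly_mapping (\<lambda>\<alpha>. c (\<alpha> + set_exponent S) $ S)) \<gamma> = c \<gamma>" for \<gamma>
    by (simp add: vec_eq_iff)
qed

lemma lookup_X_mult:
  "Poly_Mapping.lookup (X i * p) \<alpha> =
    (if Poly_Mapping.lookup \<alpha> i = 0 then 0 else Poly_Mapping.lookup p (\<alpha> - Poly_Mapping.single i 1))"
proof (induction p rule: poly_mapping_induct_single)
  case (single \<beta> c)
  have "Poly_Mapping.single i 1 + \<beta> = \<alpha> \<longleftrightarrow>
      Poly_Mapping.lookup \<alpha> i \<noteq> 0 \<and> \<beta> = \<alpha> - Poly_Mapping.single i 1"
    using minus_single_add_single[of \<alpha> i]
    by (metis add.commute add_diff_cancel_left' add_is_0 lookup_add lookup_single_eq one_neq_zero)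
  then show ?case by (auto simp: X_def mult_single lookup_single when_def)
qed (simp add: distrib_left lookup_add)

lemma lookup_of_int_mult:
  "Poly_Mapping.lookup (of_int c * p) \<alpha> = of_int c * Poly_Mapping.lookup (p :: 'n cpoly) \<alpha>"
proof -
  have "of_int c * p = Poly_Mapping.map ((*) (of_int c)) p"
    by (simp add: mult_map_scale_conv_mult flip: single_of_int)
  then show ?thesis by (simp add: Poly_Mapping.map.rep_eq when_def)
qed

lemma lookup_wedge_sign_mult:
  "Poly_Mapping.lookup (wedge_sign i S * p) \<alpha> = wedge_sign i S * Poly_Mapping.lookup (p :: 'n cpoly) \<alpha>"
  using lookup_of_int_mult[of "wedge_sign i S" p \<alpha>] by (simp add: wedge_sign_def)

lemma prod_X_power:
  "(\<Prod>i\<in>UNIV. X i ^ Poly_Mapping.lookup \<alpha> i) = Poly_Mapping.single (\<alpha> :: 'n::finite \<Rightarrow>\<^sub>0 nat) 1"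
proof -
  have X_power: "X i ^ k = Poly_Mapping.single (Poly_Mapping.single i k) 1" for i :: 'n and k
    by (induction k) (simp_all add: X_def mult_single flip: single_add)
  have "(\<Prod>i\<in>I. X i ^ Poly_Mapping.lookup \<alpha> i)
      = Poly_Mapping.single (\<Sum>i\<in>I. Poly_Mapping.single i (Poly_Mapping.lookup \<alpha> i)) 1"
    if "finite I" for I
    using that by induction (simp_all add: X_power mult_single)
  moreover have "(\<Sum>i\<in>UNIV. Poly_Mapping.single i (Poly_Mapping.lookup \<alpha> i)) = \<alpha>"
    by (intro poly_mapping_eqI) (simp add: lookup_sum lookup_single when_def)
  ultimately show ?thesis by simp
qed

lemma zero_one_exponents_eq:
  assumes "\<beta> \<in> zero_one_exponents"
  shows "{i. Poly_Mapping.lookup \<beta> i = 1} = S \<longleftrightarrow> \<beta> = set_exponent S"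
proof
  assume S: "{i. Poly_Mapping.lookup \<beta> i = 1} = S"
  show "\<beta> = set_exponent S"
    using assms by (intro poly_mapping_eqI) (force simp: lookup_set_exponent zero_one_exponents_def simp flip: S)
qed (auto simp: lookup_set_exponent)

lemma basis_indices_set_exponent:
  "(\<alpha>, set_exponent S) \<in> basis_indices A k \<longleftrightarrow> card S = k \<and> \<alpha> + set_exponent S \<in> exponent_set A"
  by (auto simp: basis_indices_def zero_one_exponents_def total_degree_def lookup_set_exponent sum.If_cases)

lemma basis_indicesE:
  assumes "x \<in> basis_indices A k"
  obtains \<alpha> S where "x = (\<alpha>, set_exponent S)" "card S = k" "\<alpha> + set_exponent S \<in> exponent_set A"
proof -
  obtain \<alpha> \<beta> where x: "x = (\<alpha>, \<beta>)" "\<beta> \<in> zero_one_exponents"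
    using assms by (auto simp: basis_indices_def)
  then have "\<beta> = set_exponent {i. Poly_Mapping.lookup \<beta> i = 1}"
    using zero_one_exponents_eq by blast
  with that assms x show ?thesis by (metis basis_indices_set_exponent)
qed

abbreviation monomial_sum ::
    "(('n \<Rightarrow>\<^sub>0 nat) \<times> ('n \<Rightarrow>\<^sub>0 nat) \<Rightarrow>\<^sub>0 complex) \<Rightarrow> 'n::{finite,linorder} cpoly chains"
  where "monomial_sum c \<equiv> (\<Sum>(\<alpha>, \<beta>)\<in>Poly_Mapping.keys c.
    chains_cscale (Poly_Mapping.lookup c (\<alpha>, \<beta>)) (monomial_form \<alpha> \<beta>))"

lemma chains_coord_monomial_form:
  assumes "\<beta> \<in> zero_one_exponents"
  shows "chains_coord (chains_cscale c (monomial_form \<alpha> \<beta>)) $ S =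
    (if \<beta> = set_exponent S then Poly_Mapping.single \<alpha> c else 0)"
proof -
  have "S = {i. Poly_Mapping.lookup \<beta> i = 1} \<longleftrightarrow> \<beta> = set_exponent S"
    using zero_one_exponents_eq[OF assms] by blast
  then show ?thesis
    by (simp add: chains_cscale_def chains_coord_scale monomial_form_def chains_coord_tensor
        forms_coord_dX_set prod_X_power axis_def of_cx_cpoly mult_single)
qed

lemma lookup_monomial_sum:
  assumes "Poly_Mapping.keys c \<subseteq> basis_indices A k"
  shows "Poly_Mapping.lookup (chains_coord (monomial_sum c) $ S) \<alpha> = Poly_Mapping.lookup c (\<alpha>, set_exponent S)"
proof -
  have "Poly_Mapping.lookup (chains_coord (monomial_sum c) $ S) \<alpha> =
    (\<Sum>x\<in>Poly_Mapping.keys c. if x = (\<alpha>, set_exponent S) then Poly_Mapping.lookup c x else 0)"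
    unfolding additive.sum[OF additive_chains_coord] sum_component lookup_sum
  proof (rule sum.cong)
    fix x assume "x \<in> Poly_Mapping.keys c"
    with assms have "snd x \<in> zero_one_exponents" by (auto simp: basis_indices_def)
    then show "Poly_Mapping.lookup (chains_coord (case x of (\<alpha>, \<beta>) \<Rightarrow>
          chains_cscale (Poly_Mapping.lookup c (\<alpha>, \<beta>)) (monomial_form \<alpha> \<beta>)) $ S) \<alpha>
        = (if x = (\<alpha>, set_exponent S) then Poly_Mapping.lookup c x else 0)"
      by (auto simp: chains_coord_monomial_form lookup_single when_def split: prod.split)
  qed simp
  also have "\<dots> = Poly_Mapping.lookup c (\<alpha>, set_exponent S)"
    by (simp add: in_keys_iff)
  finally show ?thesis .
qed


section \<open>Poisson homology\<close>

context log_poisson_module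
begin

section \<open>The boundary in a single degree\<close>

definition log_weight :: "('n \<Rightarrow>\<^sub>0 nat) \<Rightarrow> 'n \<Rightarrow> int"
  where "log_weight \<gamma> i = (\<Sum>j\<in>UNIV. A $ i $ j * (int (Poly_Mapping.lookup \<gamma> j) - 1))"

lemma exponent_set_iff:
  "\<gamma> \<in> exponent_set A \<longleftrightarrow> (\<forall>i. Poly_Mapping.lookup \<gamma> i = 0 \<or> log_weight \<gamma> i = 0)"
  by (simp add: exponent_set_def log_weight_def)

text \<open>The Euler operators X_j d/dX_j multiply a monomial by its exponents, so {X_i, -} acts as
  X_i times the sum of the a_ij \<alpha>_j; the row sum in \<open>mb_X\<close> turns \<alpha>_j into
  \<alpha>_j - 1.\<close>

lemma mb_X_single:
  "mb (Poly_Mapping.single \<alpha> c) (X i) = - of_int (log_weight \<alpha> i) * (X i * Poly_Mapping.single \<alpha> c)"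
proof -
  have X_deriv: "X j * partial_deriv j (Poly_Mapping.single \<alpha> c)
      = of_int (int (Poly_Mapping.lookup \<alpha> j)) * Poly_Mapping.single \<alpha> c" for j
  proof (rule poly_mapping_eqI)
    fix \<beta>
    show "Poly_Mapping.lookup (X j * partial_deriv j (Poly_Mapping.single \<alpha> c)) \<beta>
      = Poly_Mapping.lookup (of_int (int (Poly_Mapping.lookup \<alpha> j)) * Poly_Mapping.single \<alpha> c) \<beta>"
      unfolding lookup_of_int_mult lookup_X_mult lookup_partial_deriv
      using minus_single_add_single[of \<beta> j]
      by (auto simp: lookup_single when_def lookup_minus)
  qed
  have "pb (Poly_Mapping.single \<alpha> c) (X i)
      = (\<Sum>j\<in>UNIV. of_int (A $ j $ i) * X i * (X j * partial_deriv j (Poly_Mapping.single \<alpha> c)))"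
    by (subst pb_chain_rule[symmetric]) (simp add: pb_X mult_ac)
  also have "\<dots> = (\<Sum>j\<in>UNIV. of_int (A $ j $ i * int (Poly_Mapping.lookup \<alpha> j))) * (X i * Poly_Mapping.single \<alpha> c)"
    unfolding X_deriv sum_distrib_right by (simp add: mult_ac)
  also have "\<dots> = - (\<Sum>j\<in>UNIV. of_int (A $ i $ j * int (Poly_Mapping.lookup \<alpha> j))) * (X i * Poly_Mapping.single \<alpha> c)"
    by (subst A_skew) (simp add: sum_negf)
  finally have "pb (X i) (Poly_Mapping.single \<alpha> c)
      = (\<Sum>j\<in>UNIV. of_int (A $ i $ j * int (Poly_Mapping.lookup \<alpha> j))) * (X i * Poly_Mapping.single \<alpha> c)"
    by (subst pb_skew) simp
  then show ?thesis
    unfolding mb_X log_weight_def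
    by (simp add: sum_subtractf right_diff_distrib algebra_simps)
qed

lemma lookup_mb_X:
  "Poly_Mapping.lookup (mb p (X i)) \<alpha> = (if Poly_Mapping.lookup \<alpha> i = 0 then 0 else
    - of_int (log_weight (\<alpha> - Poly_Mapping.single i 1) i) * Poly_Mapping.lookup p (\<alpha> - Poly_Mapping.single i 1))"
proof (induction p rule: poly_mapping_induct_single)
  case (single \<beta> c)
  show ?case
    using lookup_of_int_mult[of "log_weight \<beta> i" "X i * Poly_Mapping.single \<beta> c" \<alpha>]
    by (auto simp: mb_X_single lookup_X_mult lookup_single when_def)
qed (simp add: mb_add_left lookup_add algebra_simps)

text \<open>For T = insert i S the coefficient of dX_T has exponent \<gamma> minus T. Its weight and
  the row sum over T add up to the weight of \<gamma>, whatever T is, so the factor is the same for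
  all entries of the degree.\<close>

lemma component_contract_log_bracket:
  "component (contract i (log_bracket i f)) \<gamma> = - of_int (log_weight \<gamma> i) *s contract i (component f \<gamma>)"
proof -
  have "component (contract i (log_bracket i f)) \<gamma> $ S
      = (- of_int (log_weight \<gamma> i) *s contract i (component f \<gamma>)) $ S" for S
  proof (cases "i \<notin> S \<and> covers \<gamma> (insert i S)")
    case True
    define T where "T = insert i S"
    have S: "Poly_Mapping.lookup (\<gamma> - set_exponent S) i \<noteq> 0" "covers \<gamma> S" "i \<notin> S"
      using True by (auto simp: covers_insert lookup_minus lookup_set_exponent)
    have sub: "\<gamma> - set_exponent S - Poly_Mapping.single i 1 = \<gamma> - set_exponent T"
      using True
      by (intro poly_mapping_eqI)
        (auto simp: T_def lookup_minus lookup_set_exponent lookup_single when_def)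
    have weight: "log_weight (\<gamma> - set_exponent T) i + (\<Sum>j\<in>T. A $ i $ j) = log_weight \<gamma> i"
    proof -
      have "(\<Sum>j\<in>T. A $ i $ j) = (\<Sum>j\<in>UNIV. if j \<in> T then A $ i $ j else 0)"
        by (simp add: sum.If_cases)
      moreover have "A $ i $ j * (int (Poly_Mapping.lookup (\<gamma> - set_exponent T) j) - 1)
          + (if j \<in> T then A $ i $ j else 0) = A $ i $ j * (int (Poly_Mapping.lookup \<gamma> j) - 1)" for j
        using True by (auto simp: T_def covers_def lookup_minus lookup_set_exponent of_nat_diff algebra_simps)
      ultimately show ?thesis by (simp add: log_weight_def flip: sum.distrib)
    qed
    have mb_part: "Poly_Mapping.lookup (mb (f $ T) (X i)) (\<gamma> - set_exponent S)
        = - of_int (log_weight (\<gamma> - set_exponent T) i) * Poly_Mapping.lookup (f $ T) (\<gamma> - set_exponent T)"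
      unfolding lookup_mb_X sub using S by simp
    have X_part: "Poly_Mapping.lookup (of_int c * X i * f $ T) (\<gamma> - set_exponent S)
        = of_int c * Poly_Mapping.lookup (f $ T) (\<gamma> - set_exponent T)" for c
      unfolding mult.assoc lookup_of_int_mult lookup_X_mult sub using S by simp
    have "component (contract i (log_bracket i f)) \<gamma> $ S = wedge_sign i S *
        (Poly_Mapping.lookup (mb (f $ T) (X i)) (\<gamma> - set_exponent S)
          - Poly_Mapping.lookup (of_int (\<Sum>j\<in>T. A $ i $ j) * X i * f $ T) (\<gamma> - set_exponent S))"
      using S by (simp add: component_def contract_def log_bracket_def lookup_wedge_sign_mult
          lookup_minus[of "mb _ _"] flip: T_def del: of_int_sum)
    also have "\<dots> = - of_int (log_weight (\<gamma> - set_exponent T) i + (\<Sum>j\<in>T. A $ i $ j))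
        * (wedge_sign i S * Poly_Mapping.lookup (f $ T) (\<gamma> - set_exponent T))"
      unfolding mb_part X_part of_int_add by (simp add: algebra_simps del: of_int_sum)
    also have "\<dots> = (- of_int (log_weight \<gamma> i) *s contract i (component f \<gamma>)) $ S"
      unfolding weight using True by (simp add: contract_def component_def T_def)
    finally show ?thesis .
  next
    case False
    show ?thesis
    proof (cases "i \<in> S \<or> \<not> covers \<gamma> S")
      case True
      with False show ?thesis by (auto simp: component_def contract_def covers_insert)
    next
      case outside: False
      \<comment> \<open>Here dX_i cannot occur in degree \<gamma>, and the left side vanishes too
        because \<open>log_bracket i\<close> produces multiples of X_i.\<close>
      with False have \<gamma>: "Poly_Mapping.lookup \<gamma> i = 0" by (auto simp: covers_insert)
      then have "Poly_Mapping.lookup (\<gamma> - set_exponent S) i = 0" by (simp add: lookup_minus)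
      moreover from this have "Poly_Mapping.lookup (of_int c * X i * p) (\<gamma> - set_exponent S) = 0" for c p
        unfolding mult.assoc lookup_of_int_mult lookup_X_mult by simp
      ultimately show ?thesis
        using \<gamma> by (simp add: component_def contract_def log_bracket_def covers_insert
            lookup_wedge_sign_mult lookup_minus[of "mb _ _"] lookup_mb_X del: of_int_sum)
    qed
  qed
  then show ?thesis by (simp add: vec_eq_iff)
qed

definition koszul :: "('n \<Rightarrow>\<^sub>0 nat) \<Rightarrow> complex ^ 'n set \<Rightarrow> complex ^ 'n set"
  where "koszul \<gamma> v = (\<Sum>i\<in>UNIV. - of_int (log_weight \<gamma> i) *s contract i v)"

lemma component_coord_boundary: "component (coord_boundary f) \<gamma> = koszul \<gamma> (component f \<gamma>)"
  by (simp add: coord_boundary_def koszul_def additive.sum[OF additive_component]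
      component_contract_log_bracket)

lemma koszul_zero: "koszul \<gamma> 0 = 0"
  by (simp add: koszul_def additive.zero[OF additive_contract])

lemma koszul_scale: "koszul \<gamma> (c *s v) = c *s koszul \<gamma> v"
  by (simp add: koszul_def contract_scale vec_scale_sum vector_smult_assoc mult.commute)

lemma koszul_ext_mult:
  "koszul \<gamma> (ext_mult s v) = - of_int (log_weight \<gamma> s) *s v - ext_mult s (koszul \<gamma> v)"
proof -
  have "koszul \<gamma> (ext_mult s v) + ext_mult s (koszul \<gamma> v)
      = (\<Sum>i\<in>UNIV. - of_int (log_weight \<gamma> i) *s (contract i (ext_mult s v) + ext_mult s (contract i v)))"
    unfolding koszul_def additive.sum[OF additive_ext_mult] ext_mult_scale vector_add_ldistrib sum.distrib ..
  also have "\<dots> = (\<Sum>i\<in>UNIV. if i = s then - of_int (log_weight \<gamma> s) *s v else 0)"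
    by (rule sum.cong) (auto simp: contract_ext_mult)
  finally show ?thesis by (simp add: eq_diff_eq)
qed

text \<open>Each summand vanishes: either its weight is 0, or \<gamma>_i = 0 and no set containing i
  occurs in this degree.\<close>

lemma koszul_component_eq_0:
  assumes "\<gamma> \<in> exponent_set A"
  shows "koszul \<gamma> (component f \<gamma>) = 0"
  unfolding koszul_def
proof (rule sum.neutral, rule)
  fix i
  from assms have "Poly_Mapping.lookup \<gamma> i = 0 \<or> log_weight \<gamma> i = 0"
    by (simp add: exponent_set_iff)
  then show "- of_int (log_weight \<gamma> i) *s contract i (component f \<gamma>) = 0"
    by (auto simp: vec_eq_iff contract_def component_def covers_insert)
qed

text \<open>Where the linear form does not vanish at some \<open>s\<close> with \<open>\<gamma>\<^sub>s \<noteq> 0\<close>, exterior multiplication by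
  \<open>dX\<^sub>s\<close> is a contracting homotopy up to a nonzero factor.\<close>

lemma coord_cycle_decomposition:
  assumes cycle: "coord_boundary f = 0" and degree: "\<And>S. card S \<noteq> k \<Longrightarrow> f $ S = 0"
  obtains g where "\<And>S. card S \<noteq> Suc k \<Longrightarrow> g $ S = 0"
    and "\<And>\<gamma>. component (coord_boundary g) \<gamma> = (if \<gamma> \<in> exponent_set A then 0 else component f \<gamma>)"
proof -
  define s where "s \<gamma> = (SOME i. Poly_Mapping.lookup \<gamma> i \<noteq> 0 \<and> log_weight \<gamma> i \<noteq> 0)" for \<gamma>
  have s: "Poly_Mapping.lookup \<gamma> (s \<gamma>) \<noteq> 0" "log_weight \<gamma> (s \<gamma>) \<noteq> 0" if "\<gamma> \<notin> exponent_set A" for \<gamma>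
    using someI_ex[of "\<lambda>i. Poly_Mapping.lookup \<gamma> i \<noteq> 0 \<and> log_weight \<gamma> i \<noteq> 0"] that
    by (auto simp: s_def exponent_set_iff)
  \<comment> \<open>On a cycle \<open>koszul_ext_mult\<close> leaves only minus the weight as a
    factor; the scalar inverts it.\<close>
  define h where "h \<gamma> = (if \<gamma> \<in> exponent_set A then 0
    else (- 1 / of_int (log_weight \<gamma> (s \<gamma>))) *s ext_mult (s \<gamma>) (component f \<gamma>))" for \<gamma>
  have h_nz: "\<gamma> \<notin> exponent_set A \<and> s \<gamma> \<in> S \<and> component f \<gamma> $ (S - {s \<gamma>}) \<noteq> 0" if "h \<gamma> $ S \<noteq> 0" for \<gamma> S
    using that by (auto simp: h_def ext_mult_def split: if_splits)
  obtain g where g: "component g \<gamma> = h \<gamma>" for \<gamma>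
  proof (rule ex_component[of h])
    fix S
    \<comment> \<open>The choice of s is uncontrolled in \<gamma>, but it has only finitely many
      values, so a finite union bounds the support.\<close>
    have "{\<gamma>. h \<gamma> $ S \<noteq> 0} \<subseteq> (\<Union>i. {\<gamma>. component f \<gamma> $ (S - {i}) \<noteq> 0})"
      using h_nz by blast
    then show "finite {\<gamma>. h \<gamma> $ S \<noteq> 0}"
      by (rule finite_subset) (simp add: finite_component)
  next
    fix \<gamma> :: "'n \<Rightarrow>\<^sub>0 nat" and S
    assume "\<not> covers \<gamma> S"
    \<comment> \<open>This is why s must satisfy \<gamma>_s \<noteq> 0: otherwise dX_s would leave
      the degree.\<close>
    moreover have "covers \<gamma> S" if "h \<gamma> $ S \<noteq> 0"
    proof -
      have "covers \<gamma> (S - {s \<gamma>})" using h_nz[OF that] by (auto simp: component_def split: if_splits)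
      with s(1)[of \<gamma>] h_nz[OF that] show ?thesis by (auto simp: covers_def)
    qed
    ultimately show "h \<gamma> $ S = 0" by blast
  qed (rule that)
  show thesis
  proof
    fix S :: "'n set" assume S: "card S \<noteq> Suc k"
    have "h \<gamma> $ S = 0" for \<gamma>
    proof (rule ccontr)
      assume "h \<gamma> $ S \<noteq> 0"
      from h_nz[OF this] have s_in: "s \<gamma> \<in> S" and nz: "component f \<gamma> $ (S - {s \<gamma>}) \<noteq> 0" by auto
      from nz have "f $ (S - {s \<gamma>}) \<noteq> 0" by (auto simp: component_def split: if_splits)
      with degree have "card (S - {s \<gamma>}) = k" by blast
      with S card_Suc_Diff1[OF finite s_in] show False by metis
    qed
    then show "g $ S = 0"
      by (intro poly_mapping_eqI) (simp add: g flip: component_set_exponent)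
  next
    fix \<gamma>
    have "koszul \<gamma> (component f \<gamma>) = 0"
      by (simp add: cycle flip: component_coord_boundary)
    then show "component (coord_boundary g) \<gamma> = (if \<gamma> \<in> exponent_set A then 0 else component f \<gamma>)"
      using s(2)[of \<gamma>]
      by (auto simp: component_coord_boundary g h_def koszul_scale koszul_ext_mult vector_smult_assoc
          koszul_zero additive.zero[OF additive_ext_mult])
  qed
qed

lemma chains_coord_poisson_boundary:
  "chains_coord (poisson_boundary pb mb x) = coord_boundary (chains_coord x)"
  by (simp add: poisson_boundary_coord)

lemma poisson_cycles_iff:
  "x \<in> poisson_cycles pb mb k \<longleftrightarrow> x \<in> k_chains k \<and> coord_boundary (chains_coord x) = 0"
proof -
  have "poisson_boundary pb mb x = 0 \<longleftrightarrow> coord_boundary (chains_coord x) = 0"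
    using inj_chains_coord[of "poisson_boundary pb mb x" 0]
    by (simp add: chains_coord_poisson_boundary additive.zero[OF additive_chains_coord])
  then show ?thesis by (simp add: poisson_cycles_def)
qed

section \<open>Homology classes and their normal forms\<close>

lemma equiv_homologous: "equiv (poisson_cycles pb mb k) (homologous pb mb k)"
proof -
  have add: "x + y \<in> poisson_boundaries pb mb k"
    if "x \<in> poisson_boundaries pb mb k" "y \<in> poisson_boundaries pb mb k" for x y
  proof -
    from that obtain u v where "u \<in> k_chains (Suc k)" "x = poisson_boundary pb mb u"
      "v \<in> k_chains (Suc k)" "y = poisson_boundary pb mb v"
      by (auto simp: poisson_boundaries_def)
    then have "x + y = poisson_boundary pb mb (u + v)" "u + v \<in> k_chains (Suc k)"
      by (simp_all add: poisson_boundary_coord chains_coord_add coord_boundary_add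
          chains_of_coord_add k_chains_iff)
    then show ?thesis by (auto simp: poisson_boundaries_def)
  qed
  have neg: "- x \<in> poisson_boundaries pb mb k" if "x \<in> poisson_boundaries pb mb k" for x
  proof -
    from that obtain u where "u \<in> k_chains (Suc k)" "x = poisson_boundary pb mb u"
      by (auto simp: poisson_boundaries_def)
    then have "- x = poisson_boundary pb mb (- u)" "- u \<in> k_chains (Suc k)"
      by (simp_all add: poisson_boundary_coord additive.minus[OF additive_chains_coord]
          additive.minus[OF additive_coord_boundary] additive.minus[OF additive_chains_of_coord]
          k_chains_iff)
    then show ?thesis by (auto simp: poisson_boundaries_def)
  qed
  have zero: "0 \<in> poisson_boundaries pb mb k"
  proof -
    have "0 = poisson_boundary pb mb 0" "(0 :: 'n cpoly chains) \<in> k_chains (Suc k)"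
      by (simp_all add: poisson_boundary_coord additive.zero[OF additive_chains_coord]
          additive.zero[OF additive_coord_boundary] additive.zero[OF additive_chains_of_coord]
          k_chains_iff)
    then show ?thesis unfolding poisson_boundaries_def by blast
  qed
  show ?thesis
  proof (rule equivI)
    show "homologous pb mb k \<subseteq> poisson_cycles pb mb k \<times> poisson_cycles pb mb k"
      by (auto simp: homologous_def)
    show "refl_on (poisson_cycles pb mb k) (homologous pb mb k)"
      by (auto simp: refl_on_def homologous_def zero)
    show "sym (homologous pb mb k)"
      using neg by (fastforce simp: sym_def homologous_def)
    show "trans (homologous pb mb k)"
      using add by (fastforce simp: trans_def homologous_def)
  qed
qed

lemma component_monomial_sum_eq_0:
  assumes "Poly_Mapping.keys c \<subseteq> basis_indices A k" "\<gamma> \<notin> exponent_set A"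
  shows "component (chains_coord (monomial_sum c)) \<gamma> = 0"
proof -
  have "component (chains_coord (monomial_sum c)) \<gamma> $ S = 0" for S
  proof (cases "covers \<gamma> S")
    case True
    then have "(\<gamma> - set_exponent S, set_exponent S) \<notin> Poly_Mapping.keys c"
      using assms basis_indices_set_exponent[of "\<gamma> - set_exponent S" S A k]
      by (auto simp: covers_diff_add)
    then show ?thesis by (simp add: component_def lookup_monomial_sum[OF assms(1)] in_keys_iff)
  qed (simp add: component_def)
  then show ?thesis by (simp add: vec_eq_iff)
qed

text \<open>In degrees of C the boundary vanishes, and in the other degrees the sum has no
  component.\<close>

lemma monomial_sum_in_cycles:
  assumes "Poly_Mapping.keys c \<subseteq> basis_indices A k"
  shows "monomial_sum c \<in> poisson_cycles pb mb k"
  unfolding poisson_cycles_iff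
proof
  have "chains_coord (monomial_sum c) $ S = 0" if "card S \<noteq> k" for S
  proof (rule poly_mapping_eqI)
    fix \<alpha>
    have "(\<alpha>, set_exponent S) \<notin> Poly_Mapping.keys c"
      using assms that basis_indices_set_exponent[of \<alpha> S A k] by blast
    then show "Poly_Mapping.lookup (chains_coord (monomial_sum c) $ S) \<alpha> = Poly_Mapping.lookup 0 \<alpha>"
      by (simp add: lookup_monomial_sum[OF assms] in_keys_iff)
  qed
  then show "monomial_sum c \<in> k_chains k" by (simp add: k_chains_iff)
  have "koszul \<gamma> (component (chains_coord (monomial_sum c)) \<gamma>) = 0" for \<gamma>
  proof (cases "\<gamma> \<in> exponent_set A")
    case True
    then show ?thesis by (rule koszul_component_eq_0)
  next
    case False
    with assms show ?thesis
      by (simp add: component_monomial_sum_eq_0 koszul_zero)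
  qed
  then show "coord_boundary (chains_coord (monomial_sum c)) = 0"
    by (intro component_eqI) (simp add: component_coord_boundary)
qed

text \<open>The representative is the part of z in the degrees of C; the remainder is a boundary by
  \<open>coord_cycle_decomposition\<close>.\<close>

lemma homologous_monomial_sum:
  assumes "z \<in> poisson_cycles pb mb k"
  obtains c where "Poly_Mapping.keys c \<subseteq> basis_indices A k" "(z, monomial_sum c) \<in> homologous pb mb k"
proof -
  define f where "f = chains_coord z"
  have f: "coord_boundary f = 0" "\<And>S. card S \<noteq> k \<Longrightarrow> f $ S = 0"
    using assms by (auto simp: poisson_cycles_iff k_chains_iff f_def)
  \<comment> \<open>The set where \<beta> equals 1 recovers S from
    \<open>set_exponent S\<close>.\<close>
  define c where "c = Abs_poly_mapping (\<lambda>(\<alpha>, \<beta>). if (\<alpha>, \<beta>) \<in> basis_indices A k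
    then Poly_Mapping.lookup (f $ {i. Poly_Mapping.lookup \<beta> i = 1}) \<alpha> else 0)"
  have "finite {x. (case x of (\<alpha>, \<beta>) \<Rightarrow> if (\<alpha>, \<beta>) \<in> basis_indices A k
    then Poly_Mapping.lookup (f $ {i. Poly_Mapping.lookup \<beta> i = 1}) \<alpha> else 0) \<noteq> 0}"
  proof (rule finite_subset)
    show "{x. (case x of (\<alpha>, \<beta>) \<Rightarrow> if (\<alpha>, \<beta>) \<in> basis_indices A k
        then Poly_Mapping.lookup (f $ {i. Poly_Mapping.lookup \<beta> i = 1}) \<alpha> else 0) \<noteq> 0}
      \<subseteq> (\<Union>S. (\<lambda>\<alpha>. (\<alpha>, set_exponent S)) ` Poly_Mapping.keys (f $ S))"
    proof
      fix x
      assume x: "x \<in> {x. (case x of (\<alpha>, \<beta>) \<Rightarrow> if (\<alpha>, \<beta>) \<in> basis_indices A k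
        then Poly_Mapping.lookup (f $ {i. Poly_Mapping.lookup \<beta> i = 1}) \<alpha> else 0) \<noteq> 0}"
      then have "x \<in> basis_indices A k" by (cases x) (auto split: if_splits)
      then obtain \<alpha> S where xS: "x = (\<alpha>, set_exponent S)" by (rule basis_indicesE)
      with x have "\<alpha> \<in> Poly_Mapping.keys (f $ S)"
        by (auto simp: in_keys_iff lookup_set_exponent split: if_splits)
      with xS show "x \<in> (\<Union>S. (\<lambda>\<alpha>. (\<alpha>, set_exponent S)) ` Poly_Mapping.keys (f $ S))"
        by blast
    qed
  qed simp
  then have lookup_c: "Poly_Mapping.lookup c (\<alpha>, set_exponent S) =
      (if (\<alpha>, set_exponent S) \<in> basis_indices A k then Poly_Mapping.lookup (f $ S) \<alpha> else 0)"
    and keys_c: "Poly_Mapping.keys c \<subseteq> basis_indices A k" for \<alpha> S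
    by (auto simp: c_def in_keys_iff lookup_set_exponent split: if_splits)
  obtain g where g: "\<And>S. card S \<noteq> Suc k \<Longrightarrow> g $ S = 0"
    "\<And>\<gamma>. component (coord_boundary g) \<gamma> = (if \<gamma> \<in> exponent_set A then 0 else component f \<gamma>)"
    using coord_cycle_decomposition[OF f] by blast
  have "component (chains_coord (monomial_sum c)) \<gamma> = component f \<gamma>" if "\<gamma> \<in> exponent_set A" for \<gamma>
  proof -
    have "component (chains_coord (monomial_sum c)) \<gamma> $ S = component f \<gamma> $ S" for S
    proof (cases "covers \<gamma> S")
      case True
      with that show ?thesis
        by (auto simp: component_def lookup_monomial_sum[OF keys_c] lookup_c
            basis_indices_set_exponent covers_diff_add f(2))
    qed (simp add: component_def)
    then show ?thesis by (simp add: vec_eq_iff)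
  qed
  then have "component (f - chains_coord (monomial_sum c)) \<gamma> = component (coord_boundary g) \<gamma>" for \<gamma>
    using component_monomial_sum_eq_0[OF keys_c]
    by (simp add: g(2) additive.diff[OF additive_component])
  then have "f - chains_coord (monomial_sum c) = coord_boundary g"
    by (rule component_eqI)
  then have "chains_coord (z - monomial_sum c) = chains_coord (poisson_boundary pb mb (chains_of_coord g))"
    by (simp add: chains_coord_poisson_boundary additive.diff[OF additive_chains_coord] f_def)
  then have "z - monomial_sum c = poisson_boundary pb mb (chains_of_coord g)"
    by (simp only: inj_chains_coord)
  moreover have "chains_of_coord g \<in> k_chains (Suc k)" by (simp add: k_chains_iff g(1))
  ultimately have "z - monomial_sum c \<in> poisson_boundaries pb mb k"
    by (simp add: poisson_boundaries_def)
  with assms keys_c show thesis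
    by (intro that[of c]) (simp_all add: homologous_def monomial_sum_in_cycles)
qed

text \<open>Boundaries have no component in degrees of C and monomial sums have none elsewhere, so a
  difference that is both is zero.\<close>

lemma homologous_monomial_sum_eq:
  assumes c: "Poly_Mapping.keys c \<subseteq> basis_indices A k" and d: "Poly_Mapping.keys d \<subseteq> basis_indices A k"
    and homologous: "(monomial_sum c, monomial_sum d) \<in> homologous pb mb k"
  shows "c = d"
proof -
  from homologous obtain y where "monomial_sum c - monomial_sum d = poisson_boundary pb mb y"
    by (auto simp: homologous_def poisson_boundaries_def)
  then have "chains_coord (monomial_sum c) - chains_coord (monomial_sum d) = coord_boundary (chains_coord y)"
    by (simp flip: additive.diff[OF additive_chains_coord] chains_coord_poisson_boundary)
  then have diff: "component (chains_coord (monomial_sum c)) \<gamma> - component (chains_coord (monomial_sum d)) \<gamma>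
      = koszul \<gamma> (component (chains_coord y) \<gamma>)" for \<gamma>
    by (simp flip: additive.diff[OF additive_component] component_coord_boundary)
  have "component (chains_coord (monomial_sum c)) \<gamma> = component (chains_coord (monomial_sum d)) \<gamma>" for \<gamma>
  proof (cases "\<gamma> \<in> exponent_set A")
    case True
    from diff[of \<gamma>] show ?thesis unfolding koszul_component_eq_0[OF True] by (rule eq_iff_diff_eq_0[THEN iffD2])
  next
    case False
    show ?thesis
      by (rule trans[OF component_monomial_sum_eq_0[OF c False] component_monomial_sum_eq_0[OF d False, symmetric]])
  qed
  then have eq: "chains_coord (monomial_sum c) = chains_coord (monomial_sum d)"
    by (rule component_eqI)
  show "c = d"
  proof (rule poly_mapping_eqI)
    fix x
    show "Poly_Mapping.lookup c x = Poly_Mapping.lookup d x"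
    proof (cases "x \<in> basis_indices A k")
      case True
      then obtain \<alpha> S where "x = (\<alpha>, set_exponent S)" by (rule basis_indicesE)
      then show ?thesis using lookup_monomial_sum[OF c] lookup_monomial_sum[OF d] eq by metis
    next
      case False
      with c d have "x \<notin> Poly_Mapping.keys c" "x \<notin> Poly_Mapping.keys d" by auto
      then show ?thesis by (simp add: in_keys_iff)
    qed
  qed
qed

end

theorem proposition3p5p1:
  fixes A :: "int^('n::{finite,linorder})^('n::{finite,linorder})"
    and pb mb :: "'n::{finite,linorder} cpoly \<Rightarrow> 'n cpoly \<Rightarrow> 'n cpoly"
    and k :: nat
  assumes skew: "transpose A = - A"
    and pois: "poisson_algebra pb"
    and pb_X: "\<And>i j. pb (X i) (X j) = of_int (A $ i $ j) * X i * X j"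
    and pmod: "poisson_module pb (*) mb"
    and mb_X: "\<And>m i. mb m (X i) = - pb (X i) m + of_int (\<Sum>l\<in>UNIV. A $ i $ l) * X i * m"
  shows "(\<forall>(\<alpha>, \<beta>) \<in> basis_indices A k. monomial_form \<alpha> \<beta> \<in> poisson_cycles pb mb k) \<and>
    bij_betw
      (\<lambda>c. homology_class pb mb k
        (\<Sum>(\<alpha>, \<beta>) \<in> Poly_Mapping.keys c.
          chains_cscale (Poly_Mapping.lookup c (\<alpha>, \<beta>)) (monomial_form \<alpha> \<beta>)))
      {c. Poly_Mapping.keys c \<subseteq> basis_indices A k}
      (poisson_homology pb mb k)"
proof -
  interpret poisson_module pb "(*)" mb by (rule pmod)
  interpret log_poisson_module pb mb A
    by unfold_locales (fact skew pb_X mb_X)+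
  show ?thesis
  proof
    show "\<forall>(\<alpha>, \<beta>) \<in> basis_indices A k. monomial_form \<alpha> \<beta> \<in> poisson_cycles pb mb k"
    proof clarify
      fix \<alpha> \<beta> assume "(\<alpha>, \<beta>) \<in> basis_indices A k"
      then have "monomial_sum (Poly_Mapping.single (\<alpha>, \<beta>) 1) \<in> poisson_cycles pb mb k"
        by (intro monomial_sum_in_cycles) simp
      then show "monomial_form \<alpha> \<beta> \<in> poisson_cycles pb mb k" by simp
    qed
  next
    show "bij_betw (\<lambda>c. homology_class pb mb k (monomial_sum c))
      {c. Poly_Mapping.keys c \<subseteq> basis_indices A k} (poisson_homology pb mb k)"
      unfolding bij_betw_def homology_class_def poisson_homology_def
    proof (intro conjI inj_onI subset_antisym subsetI; (elim imageE quotientE)?)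
      fix c d
      assume "c \<in> {c. Poly_Mapping.keys c \<subseteq> basis_indices A k}"
        "d \<in> {c. Poly_Mapping.keys c \<subseteq> basis_indices A k}"
        "homologous pb mb k `` {monomial_sum c} = homologous pb mb k `` {monomial_sum d}"
      then show "c = d"
        using homologous_monomial_sum_eq eq_equiv_class[OF _ equiv_homologous] monomial_sum_in_cycles
        by blast
    next
      fix H c
      assume "H = homologous pb mb k `` {monomial_sum c}" "c \<in> {c. Poly_Mapping.keys c \<subseteq> basis_indices A k}"
      then show "H \<in> poisson_cycles pb mb k // homologous pb mb k"
        by (simp add: monomial_sum_in_cycles quotientI)
    next
      fix H z
      assume H: "H = homologous pb mb k `` {z}" and z: "z \<in> poisson_cycles pb mb k"
      obtain c where "Poly_Mapping.keys c \<subseteq> basis_indices A k" "(z, monomial_sum c) \<in> homologous pb mb k"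
        using homologous_monomial_sum[OF z] by blast
      then show "H \<in> (\<lambda>c. homologous pb mb k `` {monomial_sum c}) ` {c. Poly_Mapping.keys c \<subseteq> basis_indices A k}"
        using equiv_class_eq[OF equiv_homologous] H by blast
    qed
  qed
qed

end
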